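(* There exist absolute constants $a,b>0$ such that the following holds. Let $0<\epsilon\le\Delta\le1$ and let $G$ be an $n\times n$ bimatrix game with payoff matrices in $[0,1]^{n\times n}$ that has at most $n^{a(\Delta/\epsilon)^2}$ Nash equilibria and that satisfies the well-supported $(\epsilon,\Delta)$-approximation stability condition (or the $(\epsilon/2,\Delta)$-stability to perturbations condition). Then $G$ has a well-supported $\epsilon$-equilibrium $(p,q)$ in which each of $p$ and $q$ has support of size at most $b(\Delta/\epsilon)^2\log(1+\Delta^{-1})\log n$.
   Context: Bimatrix game: row payoff $R_{i,j}$, column payoff $C_{i,j}$; mixed strategies $p,q$ are probability vectors, payoffs $p^TRq$, $p^TCq$; $e_i$ is the $i$-th unit vector; $\mathrm{supp}(p)=\{i:p_i>0\}$. Nash equilibrium: $e_i^TRq\le p^TRq$ and $p^TCe_j\le p^TCq$ for all $i,j$. Well-supported $\epsilon$-equilibrium: for every $i\in\mathrm{supp}(p)$ and all $j$, $e_i^TRq\ge e_j^TRq-\epsilon$, and for every $i\in\mathrm{supp}(q)$ and all $j$, $p^TCe_i\ge p^TCe_j-\epsilon$. Distance $d(p,p')=\frac12\sum_i|p_i-p'_i|$, $d((p,q),(p',q'))=\max(d(p,p'),d(q,q'))$; $\Delta$-close means distance $\le\Delta$. $G'$ is an $L_\infty$ $\alpha$-perturbation of $G$ if all corresponding entries of the row matrices and of the column matrices differ by at most $\alpha$ (entries need not be in $[0,1]$). $(\epsilon,\Delta)$-stability to perturbations: for every $L_\infty$ $\epsilon$-perturbation $G'$ of $G$, every Nash equilibrium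 of $G'$ is $\Delta$-close to some Nash equilibrium of $G$. Well-supported $(\epsilon,\Delta)$-approximation stability: every well-supported $\epsilon$-equilibrium of $G$ is $\Delta$-close to some Nash equilibrium of $G$. $\log$ is the natural logarithm.
   Formalization: The formal theorem assumes n ≥ 2: for n = 1 the support bound b(Δ/ε)² log(1+1/Δ) log n equals 0, while every strategy has support of size 1, so the claim fails there. *)

theory Defs
  imports Complex_Main
begin

text \<open>An n x n bimatrix game is given by R C :: nat => nat => real, only entries with
indices < n matter. Mixed strategies are functions nat => real that are probability
vectors on {..<n} and vanish outside (canonical representation, so that counting
equilibria is meaningful).\<close>

definition strat :: "nat \<Rightarrow> (nat \<Rightarrow> real) \<Rightarrow> bool" where
  "strat n p \<longleftrightarrow> (\<forall>i<n. 0 \<le> p i) \<and> (\<forall>i. n \<le> i \<longrightarrow> p i = 0) \<and> (\<Sum>i<n. p i) = 1"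

definition payoff :: "nat \<Rightarrow> (nat \<Rightarrow> nat \<Rightarrow> real) \<Rightarrow> (nat \<Rightarrow> real) \<Rightarrow> (nat \<Rightarrow> real) \<Rightarrow> real" where
  "payoff n A p q = (\<Sum>i<n. \<Sum>j<n. p i * A i j * q j)"

definition row_val :: "nat \<Rightarrow> (nat \<Rightarrow> nat \<Rightarrow> real) \<Rightarrow> (nat \<Rightarrow> real) \<Rightarrow> nat \<Rightarrow> real" where
  "row_val n R q i = (\<Sum>j<n. R i j * q j)"

definition col_val :: "nat \<Rightarrow> (nat \<Rightarrow> nat \<Rightarrow> real) \<Rightarrow> (nat \<Rightarrow> real) \<Rightarrow> nat \<Rightarrow> real" where
  "col_val n C p j = (\<Sum>i<n. p i * C i j)"

definition nash :: "nat \<Rightarrow> (nat \<Rightarrow> nat \<Rightarrow> real) \<Rightarrow> (nat \<Rightarrow> nat \<Rightarrow> real) \<Rightarrow> (nat \<Rightarrow> real) \<Rightarrow> (nat \<Rightarrow> real) \<Rightarrow> bool" where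
  "nash n R C p q \<longleftrightarrow> strat n p \<and> strat n q \<and>
     (\<forall>i<n. row_val n R q i \<le> payoff n R p q) \<and>
     (\<forall>j<n. col_val n C p j \<le> payoff n C p q)"

definition ws_eq :: "nat \<Rightarrow> (nat \<Rightarrow> nat \<Rightarrow> real) \<Rightarrow> (nat \<Rightarrow> nat \<Rightarrow> real) \<Rightarrow> real \<Rightarrow> (nat \<Rightarrow> real) \<Rightarrow> (nat \<Rightarrow> real) \<Rightarrow> bool" where
  "ws_eq n R C eps p q \<longleftrightarrow> strat n p \<and> strat n q \<and>
     (\<forall>i<n. 0 < p i \<longrightarrow> (\<forall>j<n. row_val n R q j - eps \<le> row_val n R q i)) \<and>
     (\<forall>i<n. 0 < q i \<longrightarrow> (\<forall>j<n. col_val n C p j - eps \<le> col_val n C p i))"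

definition sdist :: "nat \<Rightarrow> (nat \<Rightarrow> real) \<Rightarrow> (nat \<Rightarrow> real) \<Rightarrow> real" where
  "sdist n p p' = (1/2) * (\<Sum>i<n. \<bar>p i - p' i\<bar>)"

definition pdist :: "nat \<Rightarrow> (nat \<Rightarrow> real) \<times> (nat \<Rightarrow> real) \<Rightarrow> (nat \<Rightarrow> real) \<times> (nat \<Rightarrow> real) \<Rightarrow> real" where
  "pdist n pq pq' = max (sdist n (fst pq) (fst pq')) (sdist n (snd pq) (snd pq'))"

definition nash_set :: "nat \<Rightarrow> (nat \<Rightarrow> nat \<Rightarrow> real) \<Rightarrow> (nat \<Rightarrow> nat \<Rightarrow> real) \<Rightarrow> ((nat \<Rightarrow> real) \<times> (nat \<Rightarrow> real)) set" where
  "nash_set n R C = {(p, q). nash n R C p q}"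

definition ws_approx_stable :: "nat \<Rightarrow> (nat \<Rightarrow> nat \<Rightarrow> real) \<Rightarrow> (nat \<Rightarrow> nat \<Rightarrow> real) \<Rightarrow> real \<Rightarrow> real \<Rightarrow> bool" where
  "ws_approx_stable n R C eps Delta \<longleftrightarrow>
     (\<forall>p q. ws_eq n R C eps p q \<longrightarrow> (\<exists>pq' \<in> nash_set n R C. pdist n (p, q) pq' \<le> Delta))"

definition perturbation :: "nat \<Rightarrow> (nat \<Rightarrow> nat \<Rightarrow> real) \<Rightarrow> (nat \<Rightarrow> nat \<Rightarrow> real) \<Rightarrow> (nat \<Rightarrow> nat \<Rightarrow> real) \<Rightarrow> (nat \<Rightarrow> nat \<Rightarrow> real) \<Rightarrow> real \<Rightarrow> bool" where
  "perturbation n R C R' C' alpha \<longleftrightarrow>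
     (\<forall>i<n. \<forall>j<n. \<bar>R' i j - R i j\<bar> \<le> alpha \<and> \<bar>C' i j - C i j\<bar> \<le> alpha)"

definition perturb_stable :: "nat \<Rightarrow> (nat \<Rightarrow> nat \<Rightarrow> real) \<Rightarrow> (nat \<Rightarrow> nat \<Rightarrow> real) \<Rightarrow> real \<Rightarrow> real \<Rightarrow> bool" where
  "perturb_stable n R C eps Delta \<longleftrightarrow>
     (\<forall>R' C'. perturbation n R C R' C' eps \<longrightarrow>
        (\<forall>pq \<in> nash_set n R' C'. \<exists>pq' \<in> nash_set n R C. pdist n pq pq' \<le> Delta))"

definition supp :: "nat \<Rightarrow> (nat \<Rightarrow> real) \<Rightarrow> nat set" where
  "supp n p = {i. i < n \<and> 0 < p i}"

end

theory Submission
  imports Defs "HOL-Analysis.Analysis"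
begin

text \<open>
  Let (p, q) be a Nash equilibrium. A strategy p' whose support lies in that of p and which changes
  every column payoff by at most eps/2 still forms, together with q, a well-supported
  eps-equilibrium, so stability puts p' within Delta of one of the few equilibrium strategies.
  Replacing a part of p of mass m = 8 Delta by the empirical measure of S samples drawn from that
  part changes payoffs by at most eps/2 once S is of order (Delta/eps)^2 log n (Hoeffding).
  If the normalised part P is spread out (all atoms at most 1/(40 S)), the resampled strategy comes
  within Delta of a fixed strategy r with probability at most 2^(-S), as this forces half of the
  samples into a set of P-measure at most 1/16 determined by r; the union bound over the
  equilibria then contradicts stability.
  If no such spread part exists, every step of removing the 40 S heaviest remaining atoms at least
  halves the remaining mass as long as that mass exceeds m. After log(1/Delta) steps a remainder of
  mass at most m is left, and resampling it yields a strategy of small support.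
  The other player is treated symmetrically.
\<close>

section \<open>Brouwer's fixed point theorem for cubes of arbitrary dimension\<close>

text \<open>The dimension must be a natural number rather than a type, so the library's version of
  Brouwer's theorem for Euclidean spaces does not apply; Kuhn's combinatorial lemma does.\<close>

definition unit_cube :: "nat \<Rightarrow> (nat \<Rightarrow> real) set" where
  "unit_cube d = {x. (\<forall>i<d. 0 \<le> x i \<and> x i \<le> 1) \<and> (\<forall>i\<ge>d. x i = 0)}"

text \<open>Tychonoff: coordinates from \<open>d\<close> on range over the singleton of 0, so the
  cube is a product of compact sets.\<close>

lemma compact_unit_cube: "compact (unit_cube d)"
proof -
  have "unit_cube d = PiE UNIV (\<lambda>i. if i < d then {0..1} else {0})"
    by (auto simp: unit_cube_def PiE_def Pi_def not_less split: if_splits)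
  moreover have "compactin (product_topology (\<lambda>_. euclidean) UNIV)
      (PiE UNIV (\<lambda>i::nat. if i < d then {0..1::real} else {0}))"
    by (simp add: compactin_PiE)
  ultimately show ?thesis
    by (simp add: euclidean_product_topology flip: compactin_euclidean_iff)
qed

lemma tendsto_coordinatewise:
  fixes x :: "nat \<Rightarrow> nat \<Rightarrow> real"
  assumes "\<And>i. (\<lambda>k. x k i) \<longlonglongrightarrow> z i"
  shows "x \<longlonglongrightarrow> z"
proof -
  have "limitin (product_topology (\<lambda>_. euclidean) UNIV) x z sequentially"
    unfolding limitin_componentwise using assms by (auto simp: limitin_canonical_iff)
  then show ?thesis
    by (simp add: euclidean_product_topology limitin_canonical_iff)
qed

lemma tendsto_coordinate:
  fixes x :: "nat \<Rightarrow> nat \<Rightarrow> real"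
  assumes "x \<longlonglongrightarrow> z"
  shows "(\<lambda>k. x k i) \<longlonglongrightarrow> z i"
proof -
  have "continuous_on UNIV (\<lambda>w::nat \<Rightarrow> real. w i)"
    by (rule continuous_on_product_coordinates)
  then show ?thesis
    by (rule continuous_on_tendsto_compose[OF _ assms]) auto
qed

text \<open>On the grid of mesh \<open>1 / N\<close>, vertices are labelled in each coordinate by
  whether \<open>f\<close> moves them up or down. Kuhn's lemma yields a cell in which every
  coordinate sees both labels.\<close>

lemma brouwer_unit_cube_cell:
  fixes f :: "(nat \<Rightarrow> real) \<Rightarrow> nat \<Rightarrow> real"
  assumes maps: "\<And>x i. x \<in> unit_cube d \<Longrightarrow> i < d \<Longrightarrow> 0 \<le> f x i \<and> f x i \<le> 1"
    and N: "0 < N"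
  shows "\<exists>z\<in>unit_cube d. \<forall>i<d. \<exists>r\<in>unit_cube d. \<exists>s\<in>unit_cube d.
    (\<forall>j. \<bar>r j - z j\<bar> \<le> 1 / real N) \<and> (\<forall>j. \<bar>s j - z j\<bar> \<le> 1 / real N) \<and> r i \<le> f r i \<and> f s i \<le> s i"
proof -
  define g :: "(nat \<Rightarrow> nat) \<Rightarrow> nat \<Rightarrow> real" where
    "g x = (\<lambda>i. if i < d then real (x i) / real N else 0)" for x
  \<comment> \<open>On the two faces of coordinate \<open>i\<close> the label is forced, as Kuhn's
    lemma demands; it still tells the truth there because \<open>f\<close> stays within
    [0, 1].\<close>
  define label :: "(nat \<Rightarrow> nat) \<Rightarrow> nat \<Rightarrow> nat" where
    "label x i = (if x i \<noteq> N \<and> (x i = 0 \<or> g x i \<le> f (g x) i) then 0 else 1)" for x i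
  have label_le: "label x i \<le> 1" for x i by (simp add: label_def)
  have g_in: "g x \<in> unit_cube d" if "\<And>i. i < d \<Longrightarrow> x i \<le> N" for x
    using that N by (auto simp: g_def unit_cube_def divide_simps)
  obtain q where q: "\<forall>i<d. q i < N"
    and cell: "\<forall>i<d. \<exists>r s. (\<forall>j<d. q j \<le> r j \<and> r j \<le> q j + 1) \<and>
      (\<forall>j<d. q j \<le> s j \<and> s j \<le> q j + 1) \<and> label r i \<noteq> label s i"
  proof (rule kuhn_lemma[of N d label])
    show "0 < N" by (rule N)
  qed (use N in \<open>auto simp: label_def\<close>)
  have near: "\<bar>g r j - g q j\<bar> \<le> 1 / real N" if "\<forall>j<d. q j \<le> r j \<and> r j \<le> q j + 1" for r j
  proof (cases "j < d")
    case True
    have "\<bar>real (r j) - real (q j)\<bar> \<le> 1" using that True by fastforce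
    then have "\<bar>real (r j) - real (q j)\<bar> / real N \<le> 1 / real N"
      by (rule divide_right_mono) simp
    then show ?thesis using True N by (simp add: g_def flip: diff_divide_distrib)
  qed (simp add: g_def)
  have lab0: "g r i \<le> f (g r) i" if "label r i = 0" "\<forall>j<d. r j \<le> N" "i < d" for r i
  proof (cases "r i = 0")
    case True
    then show ?thesis using maps[OF g_in, of r i] that by (auto simp: g_def)
  qed (use that in \<open>auto simp: label_def split: if_splits\<close>)
  have lab1: "f (g r) i \<le> g r i" if "label r i \<noteq> 0" "\<forall>j<d. r j \<le> N" "i < d" for r i
  proof (cases "r i = N")
    case True
    then show ?thesis using maps[OF g_in, of r i] that N by (auto simp: g_def)
  qed (use that in \<open>auto simp: label_def split: if_splits\<close>)
  show ?thesis
  proof (rule bexI[of _ "g q"], rule allI, rule impI)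
    show "g q \<in> unit_cube d" using q by (intro g_in) auto
    fix i assume i: "i < d"
    obtain r s where rs: "\<forall>j<d. q j \<le> r j \<and> r j \<le> q j + 1"
      "\<forall>j<d. q j \<le> s j \<and> s j \<le> q j + 1" "label r i \<noteq> label s i"
      using cell i by blast
    have le: "\<forall>j<d. r j \<le> N" "\<forall>j<d. s j \<le> N"
      using rs(1,2) q by (fastforce dest: spec)+
    have "(\<forall>j. \<bar>g r j - g q j\<bar> \<le> 1 / real N)" "(\<forall>j. \<bar>g s j - g q j\<bar> \<le> 1 / real N)"
      using near rs by blast+
    moreover have "g r \<in> unit_cube d" "g s \<in> unit_cube d" using g_in le by auto
    moreover have "g r i \<le> f (g r) i \<and> f (g s) i \<le> g s i \<or> g s i \<le> f (g s) i \<and> f (g r) i \<le> g r i"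
      using rs(3) label_le[of r i] label_le[of s i] lab0[OF _ le(1) i] lab0[OF _ le(2) i] lab1[OF _ le(1) i] lab1[OF _ le(2) i]
      by (cases "label r i = 0"; cases "label s i = 0") auto
    ultimately show "\<exists>r\<in>unit_cube d. \<exists>s\<in>unit_cube d. (\<forall>j. \<bar>r j - g q j\<bar> \<le> 1 / real N) \<and>
        (\<forall>j. \<bar>s j - g q j\<bar> \<le> 1 / real N) \<and> r i \<le> f r i \<and> f s i \<le> s i"
      by blast
  qed
qed

text \<open>Cells of mesh tending to 0 accumulate at a point \<open>l\<close> by compactness. Their
  corners share this limit, so continuity turns the two opposite corner inequalities into
  \<open>f l i = l i\<close>.\<close>

lemma brouwer_unit_cube:
  fixes f :: "(nat \<Rightarrow> real) \<Rightarrow> nat \<Rightarrow> real"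
  assumes maps: "\<And>x i. x \<in> unit_cube d \<Longrightarrow> i < d \<Longrightarrow> 0 \<le> f x i \<and> f x i \<le> 1"
    and cont: "\<And>i. i < d \<Longrightarrow> continuous_on (unit_cube d) (\<lambda>x. f x i)"
  shows "\<exists>x\<in>unit_cube d. \<forall>i<d. f x i = x i"
proof -
  define corner where "corner k i z r s \<longleftrightarrow> r \<in> unit_cube d \<and> s \<in> unit_cube d \<and>
    (\<forall>j. \<bar>r j - z j\<bar> \<le> 1 / real (Suc k)) \<and> (\<forall>j. \<bar>s j - z j\<bar> \<le> 1 / real (Suc k)) \<and>
    r i \<le> f r i \<and> f s i \<le> s i" for k i and z r s :: "nat \<Rightarrow> real"
  have "\<forall>k. \<exists>z. z \<in> unit_cube d \<and> (\<forall>i<d. \<exists>r s. corner k i z r s)"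
  proof
    fix k
    have "\<exists>z\<in>unit_cube d. \<forall>i<d. \<exists>r\<in>unit_cube d. \<exists>s\<in>unit_cube d.
      (\<forall>j. \<bar>r j - z j\<bar> \<le> 1 / real (Suc k)) \<and> (\<forall>j. \<bar>s j - z j\<bar> \<le> 1 / real (Suc k)) \<and>
      r i \<le> f r i \<and> f s i \<le> s i"
      by (rule brouwer_unit_cube_cell) (use maps in auto)
    then show "\<exists>z. z \<in> unit_cube d \<and> (\<forall>i<d. \<exists>r s. corner k i z r s)"
      unfolding corner_def Bex_def by (simp only: conj_assoc ex_simps)
  qed
  from choice[OF this] obtain z where z: "\<And>k. z k \<in> unit_cube d"
    and cell: "\<And>k i. i < d \<Longrightarrow> \<exists>r s. corner k i (z k) r s"
    by blast
  obtain l \<sigma> where l: "l \<in> unit_cube d" "strict_mono \<sigma>" "(z \<circ> \<sigma>) \<longlonglongrightarrow> l"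
    using seq_compactE[OF compact_imp_seq_compact[OF compact_unit_cube], of z d] z by blast
  have lim0: "(\<lambda>k. 1 / real (Suc (\<sigma> k))) \<longlonglongrightarrow> 0"
    using LIMSEQ_subseq_LIMSEQ[OF lim_1_over_n[THEN LIMSEQ_Suc] l(2)] by (simp add: o_def)
  have close_lim: "r \<longlonglongrightarrow> l" if "\<And>k j. \<bar>r k j - z (\<sigma> k) j\<bar> \<le> 1 / real (Suc (\<sigma> k))" for r
  proof (rule tendsto_coordinatewise)
    fix j
    have "(\<lambda>k. r k j - z (\<sigma> k) j) \<longlonglongrightarrow> 0"
      by (rule Lim_null_comparison[OF _ lim0]) (use that in auto)
    moreover have "(\<lambda>k. z (\<sigma> k) j) \<longlonglongrightarrow> l j"
      using tendsto_coordinate[OF l(3)] by (simp add: o_def)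
    ultimately have "(\<lambda>k. (r k j - z (\<sigma> k) j) + z (\<sigma> k) j) \<longlonglongrightarrow> 0 + l j"
      by (rule tendsto_add)
    then show "(\<lambda>k. r k j) \<longlonglongrightarrow> l j" by simp
  qed
  show ?thesis
  proof (rule bexI[OF _ l(1)], rule allI, rule impI)
    fix i assume i: "i < d"
    have "\<forall>k. \<exists>rs. corner (\<sigma> k) i (z (\<sigma> k)) (fst rs) (snd rs)"
      using cell[OF i] by simp
    from choice[OF this] obtain rs where rs: "\<And>k. corner (\<sigma> k) i (z (\<sigma> k)) (fst (rs k)) (snd (rs k))"
      by blast
    define r s where "r k = fst (rs k)" and "s k = snd (rs k)" for k
    have rs: "r k \<in> unit_cube d" "s k \<in> unit_cube d"
      "\<bar>r k j - z (\<sigma> k) j\<bar> \<le> 1 / real (Suc (\<sigma> k))"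
      "\<bar>s k j - z (\<sigma> k) j\<bar> \<le> 1 / real (Suc (\<sigma> k))"
      "r k i \<le> f (r k) i" "f (s k) i \<le> s k i" for k j
      using rs[of k] by (simp_all add: corner_def r_def s_def)
    have r: "r \<longlonglongrightarrow> l" by (rule close_lim) (rule rs)
    have s: "s \<longlonglongrightarrow> l" by (rule close_lim) (rule rs)
    have fr: "(\<lambda>k. f (r k) i) \<longlonglongrightarrow> f l i"
      by (rule continuous_on_tendsto_compose[OF cont[OF i] r l(1)]) (simp add: rs)
    have fs: "(\<lambda>k. f (s k) i) \<longlonglongrightarrow> f l i"
      by (rule continuous_on_tendsto_compose[OF cont[OF i] s l(1)]) (simp add: rs)
    have "l i \<le> f l i"
      using LIMSEQ_le[OF tendsto_coordinate[OF r] fr] rs(5) by simp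
    moreover have "f l i \<le> l i"
      using LIMSEQ_le[OF fs tendsto_coordinate[OF s]] rs(6) by simp
    ultimately show "f l i = l i" by simp
  qed
qed

section \<open>Existence of Nash equilibria and perturbations\<close>

lemma col_val_eq_row_val: "col_val n C p j = row_val n (\<lambda>k i. C i k) p j"
  by (simp add: col_val_def row_val_def mult.commute)

lemma payoff_rows: "payoff n A p q = (\<Sum>i<n. p i * row_val n A q i)"
  by (simp add: payoff_def row_val_def sum_distrib_left mult.assoc)

lemma payoff_cols: "payoff n A p q = (\<Sum>j<n. q j * col_val n A p j)"
  unfolding payoff_def col_val_def sum_distrib_left
  by (subst sum.swap) (simp add: mult_ac)

lemma strat_exists_le_average:
  assumes p: "strat n p"
  shows "\<exists>i<n. 0 < p i \<and> v i \<le> (\<Sum>k<n. p k * v k)"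
proof (rule ccontr)
  define avg where "avg = (\<Sum>k<n. p k * v k)"
  assume "\<not> ?thesis"
  then have gt: "avg < v i" if "i < n" "0 < p i" for i
    using that unfolding avg_def by fastforce
  have p1: "(\<Sum>i<n. p i) = 1" and p0: "\<And>i. i < n \<Longrightarrow> 0 \<le> p i"
    using p by (auto simp: strat_def)
  then obtain i where i: "i < n" "0 < p i"
    by (metis lessThan_iff less_eq_real_def sum.neutral zero_neq_one)
  have "(\<Sum>k<n. p k * avg) < (\<Sum>k<n. p k * v k)"
  proof (rule sum_strict_mono_ex1)
    show "\<forall>k\<in>{..<n}. p k * avg \<le> p k * v k"
      using gt p0 by (metis lessThan_iff less_eq_real_def mult_left_mono mult_zero_left)
    show "\<exists>k\<in>{..<n}. p k * avg < p k * v k"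
      using i gt by (intro bexI[of _ i]) auto
  qed simp
  then show False by (simp add: avg_def p1 flip: sum_distrib_right)
qed

text \<open>A retraction of the nonnegative orthant onto the probability simplex.\<close>

definition to_simplex :: "nat \<Rightarrow> (nat \<Rightarrow> real) \<Rightarrow> nat \<Rightarrow> real" where
  "to_simplex n u i = (if i < n then
     (u i + max 0 (1 - (\<Sum>k<n. u k))) / ((\<Sum>k<n. u k) + real n * max 0 (1 - (\<Sum>k<n. u k))) else 0)"

text \<open>If the sum is below 1, adding its deficit \<open>n\<close> times lifts it to at least 1;
  otherwise it is at least 1 already.\<close>

lemma to_simplex_denominator_pos:
  assumes "0 < n"
  shows "0 < (\<Sum>k<n. u k) + real n * max 0 (1 - (\<Sum>k<n. u k))"
proof (cases "(\<Sum>k<n. u k) < 1")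
  case True
  have "1 * max 0 (1 - (\<Sum>k<n. u k)) \<le> real n * max 0 (1 - (\<Sum>k<n. u k))"
    using assms by (intro mult_right_mono) auto
  then show ?thesis by (simp add: max_def split: if_splits)
qed simp

lemma strat_to_simplex:
  assumes "0 < n" "\<And>i. i < n \<Longrightarrow> 0 \<le> u i"
  shows "strat n (to_simplex n u)"
  unfolding strat_def
proof (intro conjI allI impI)
  let ?D = "(\<Sum>k<n. u k) + real n * max 0 (1 - (\<Sum>k<n. u k))"
  have D: "0 < ?D" using assms to_simplex_denominator_pos by blast
  show "0 \<le> to_simplex n u i" if "i < n" for i
    using that assms D by (auto simp: to_simplex_def intro!: divide_nonneg_pos)
  have "(\<Sum>i<n. to_simplex n u i) = (\<Sum>i<n. u i + max 0 (1 - (\<Sum>k<n. u k))) / ?D"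
    by (simp add: to_simplex_def sum_divide_distrib)
  also have "\<dots> = 1" using D by (simp add: sum.distrib)
  finally show "(\<Sum>i<n. to_simplex n u i) = 1" .
qed (simp add: to_simplex_def)

lemma to_simplex_id: "(\<Sum>k<n. u k) = 1 \<Longrightarrow> i < n \<Longrightarrow> to_simplex n u i = u i"
  by (simp add: to_simplex_def)

lemma continuous_on_to_simplex:
  fixes u :: "'a::topological_space \<Rightarrow> nat \<Rightarrow> real"
  assumes "0 < n" "\<And>i. continuous_on S (\<lambda>x. u x i)"
  shows "continuous_on S (\<lambda>x. to_simplex n (u x) i)"
proof (cases "i < n")
  case True
  have "(\<Sum>k<n. u x k) + real n * max 0 (1 - (\<Sum>k<n. u x k)) \<noteq> 0" for x
    using to_simplex_denominator_pos[OF assms(1), of "u x"] by linarith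
  then show ?thesis
    using True by (simp add: to_simplex_def) (intro continuous_intros assms ballI; simp)
qed (simp add: to_simplex_def)

section \<open>Nash's improvement map\<close>

definition gain :: "nat \<Rightarrow> (nat \<Rightarrow> nat \<Rightarrow> real) \<Rightarrow> (nat \<Rightarrow> real) \<Rightarrow> (nat \<Rightarrow> real) \<Rightarrow> nat \<Rightarrow> real" where
  "gain n A p q i = max 0 (row_val n A q i - (\<Sum>k<n. p k * row_val n A q k))"

text \<open>Nash's map: weight shifts toward actions that beat the average, and a strategy fixed by
  it is a best response.\<close>

definition nash_map :: "nat \<Rightarrow> (nat \<Rightarrow> nat \<Rightarrow> real) \<Rightarrow> (nat \<Rightarrow> real) \<Rightarrow> (nat \<Rightarrow> real) \<Rightarrow> nat \<Rightarrow> real" where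
  "nash_map n A p q i = (p i + gain n A p q i) / (1 + (\<Sum>k<n. gain n A p q k))"

lemma gain_nonneg: "0 \<le> gain n A p q i"
  by (simp add: gain_def)

lemma one_plus_sum_gain_pos: "0 < 1 + (\<Sum>k<n. gain n A p q k)"
  by (simp add: add_pos_nonneg gain_nonneg sum_nonneg)

lemma nash_map_nonneg: "strat n p \<Longrightarrow> i < n \<Longrightarrow> 0 \<le> nash_map n A p q i"
  using one_plus_sum_gain_pos[of n A p q]
  by (auto simp: nash_map_def strat_def gain_nonneg intro!: divide_nonneg_pos)

lemma sum_nash_map: "strat n p \<Longrightarrow> (\<Sum>i<n. nash_map n A p q i) = 1"
  using one_plus_sum_gain_pos[of n A p q]
  by (simp add: nash_map_def strat_def sum.distrib flip: sum_divide_distrib)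

lemma nash_map_le_one:
  assumes "strat n p" "i < n"
  shows "nash_map n A p q i \<le> 1"
  using member_le_sum[of i "{..<n}" "nash_map n A p q"] nash_map_nonneg[OF assms(1)] assms
  by (simp add: sum_nash_map)

lemma continuous_on_nash_map:
  fixes p q :: "'a::topological_space \<Rightarrow> nat \<Rightarrow> real"
  assumes "\<And>i. continuous_on S (\<lambda>x. p x i)" "\<And>i. continuous_on S (\<lambda>x. q x i)"
  shows "continuous_on S (\<lambda>x. nash_map n A (p x) (q x) i)"
proof -
  have g: "continuous_on S (\<lambda>x. gain n A (p x) (q x) i)" for i
    unfolding gain_def row_val_def by (intro continuous_intros assms)
  have "1 + (\<Sum>k<n. gain n A (p x) (q x) k) \<noteq> 0" for x
    using one_plus_sum_gain_pos[of n A "p x" "q x"] by linarith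
  then show ?thesis
    unfolding nash_map_def by (intro continuous_intros assms g ballI)
qed

text \<open>At a fixed point \<open>gain\<close> is \<open>p\<close> times the total gain
  \<open>G\<close>. Some played action does no better than average and has gain 0, hence
  \<open>G = 0\<close> and no action gains.\<close>

lemma nash_map_fixpoint_best_response:
  assumes p: "strat n p" and fp: "\<And>i. i < n \<Longrightarrow> nash_map n A p q i = p i" and i: "i < n"
  shows "row_val n A q i \<le> (\<Sum>k<n. p k * row_val n A q k)"
proof -
  define G where "G = (\<Sum>k<n. gain n A p q k)"
  have eq: "gain n A p q k = p k * G" if "k < n" for k
    using fp[OF that] one_plus_sum_gain_pos[of n A p q]
    by (simp add: nash_map_def G_def field_simps)
  obtain k where k: "k < n" "0 < p k" "row_val n A q k \<le> (\<Sum>k<n. p k * row_val n A q k)"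
    using strat_exists_le_average[OF p] by blast
  then have "gain n A p q k = 0" by (simp add: gain_def)
  then have "G = 0" using eq k by simp
  then have "gain n A p q i = 0" using eq i by simp
  then show ?thesis by (simp add: gain_def max_def split: if_splits)
qed

theorem nash_exists:
  assumes n: "0 < n"
  shows "\<exists>p q. nash n R C p q"
proof -
  \<comment> \<open>One point of the 2n-dimensional cube encodes both players; each half is
    retracted to a strategy before Nash's map is applied.\<close>
  define P where "P x = to_simplex n x" for x :: "nat \<Rightarrow> real"
  define Q where "Q x = to_simplex n (\<lambda>j. x (n + j))" for x :: "nat \<Rightarrow> real"
  define f where "f x i = (if i < n then nash_map n R (P x) (Q x) i
    else nash_map n (\<lambda>j i. C i j) (Q x) (P x) (i - n))" for x i
  have strats: "strat n (P x)" "strat n (Q x)" if "x \<in> unit_cube (n + n)" for x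
    using that n by (auto simp: P_def Q_def unit_cube_def intro!: strat_to_simplex)
  have coord: "continuous_on S (\<lambda>x::nat \<Rightarrow> real. x i)" for S i
    by (rule continuous_on_subset[OF continuous_on_product_coordinates]) simp
  have contP: "continuous_on S (\<lambda>x. P x i)" and contQ: "continuous_on S (\<lambda>x. Q x i)" for S i
    unfolding P_def Q_def by (rule continuous_on_to_simplex[OF n], rule coord)+
  have "\<exists>x\<in>unit_cube (n + n). \<forall>i<n + n. f x i = x i"
  proof (rule brouwer_unit_cube)
    fix x i assume "x \<in> unit_cube (n + n)" "i < n + n"
    then show "0 \<le> f x i \<and> f x i \<le> 1"
      using strats[of x] by (auto simp: f_def nash_map_nonneg nash_map_le_one)
  next
    fix i assume "i < n + n"
    show "continuous_on (unit_cube (n + n)) (\<lambda>x. f x i)"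
      unfolding f_def by (cases "i < n") (simp_all add: continuous_on_nash_map contP contQ)
  qed
  then obtain x where x: "x \<in> unit_cube (n + n)" and fx: "\<And>i. i < n + n \<Longrightarrow> f x i = x i"
    by blast
  have fp: "x i = nash_map n R (P x) (Q x) i"
    and fq: "x (n + i) = nash_map n (\<lambda>j i. C i j) (Q x) (P x) i" if "i < n" for i
    using fx[of i] fx[of "n + i"] that by (simp_all add: f_def)
  \<comment> \<open>Each half of a fixed point is a value of \<open>nash_map\<close> and so sums to
    1, whence the retraction does not move it.\<close>
  have "P x i = x i" if "i < n" for i
    unfolding P_def by (rule to_simplex_id) (use that strats[OF x] in \<open>simp_all add: fp sum_nash_map\<close>)
  moreover have "Q x i = x (n + i)" if "i < n" for i
    unfolding Q_def by (rule to_simplex_id) (use that strats[OF x] in \<open>simp_all add: fq sum_nash_map\<close>)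
  ultimately have "nash_map n R (P x) (Q x) i = P x i"
      "nash_map n (\<lambda>j i. C i j) (Q x) (P x) i = Q x i" if "i < n" for i
    using fp fq that by auto
  then have "nash n R C (P x) (Q x)"
    unfolding nash_def payoff_rows[of n R] payoff_cols[of n C] col_val_eq_row_val
    using strats[OF x] nash_map_fixpoint_best_response by blast
  then show ?thesis by blast
qed

section \<open>Well-supported equilibria as equilibria of perturbed games\<close>

lemma strat_sum_eq_bound_imp_eq:
  assumes p: "strat n p" and le: "\<And>i. i < n \<Longrightarrow> v i \<le> (\<Sum>k<n. p k * v k)" and i: "i < n" "0 < p i"
  shows "v i = (\<Sum>k<n. p k * v k)"
proof (rule ccontr)
  define avg where "avg = (\<Sum>k<n. p k * v k)"
  assume "v i \<noteq> (\<Sum>k<n. p k * v k)"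
  then have "v i < avg" using le i by (force simp: avg_def)
  have "(\<Sum>k<n. p k * v k) < (\<Sum>k<n. p k * avg)"
  proof (rule sum_strict_mono_ex1)
    show "\<forall>k\<in>{..<n}. p k * v k \<le> p k * avg"
      using le p by (auto simp: strat_def avg_def intro!: mult_left_mono)
    show "\<exists>k\<in>{..<n}. p k * v k < p k * avg"
      using i \<open>v i < avg\<close> by (intro bexI[of _ i]) auto
  qed simp
  then show False using p by (simp add: avg_def strat_def flip: sum_distrib_right)
qed

lemma nash_imp_ws_eq_zero:
  assumes "nash n R C p q"
  shows "ws_eq n R C 0 p q"
proof -
  have s: "strat n p" "strat n q" using assms by (auto simp: nash_def)
  have r: "\<And>i. i < n \<Longrightarrow> row_val n R q i \<le> (\<Sum>k<n. p k * row_val n R q k)"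
    and c: "\<And>i. i < n \<Longrightarrow> col_val n C p i \<le> (\<Sum>k<n. q k * col_val n C p k)"
    using assms unfolding nash_def payoff_rows[of n R] payoff_cols[of n C] by auto
  show ?thesis unfolding ws_eq_def
    using s r c strat_sum_eq_bound_imp_eq[OF s(1) r] strat_sum_eq_bound_imp_eq[OF s(2) c] by auto
qed

text \<open>With \<open>m\<close> the largest value, shifting every played value to \<open>m - eps / 2\<close> and every other
  value down by \<open>eps / 2\<close> makes all played actions optimal.\<close>

lemma ws_best_response_shift:
  assumes p: "strat n p" and eps: "0 \<le> eps"
    and ws: "\<And>i j. i < n \<Longrightarrow> 0 < p i \<Longrightarrow> j < n \<Longrightarrow> v j - eps \<le> v i"
  shows "\<exists>s::nat \<Rightarrow> real. (\<forall>i<n. \<bar>s i\<bar> \<le> eps / 2) \<and> (\<forall>i<n. v i + s i \<le> (\<Sum>k<n. p k * (v k + s k)))"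
proof -
  obtain i0 where i0: "i0 < n" "0 < p i0" using strat_exists_le_average[OF p] by blast
  define m where "m = Max (v ` {..<n})"
  have ub: "v i \<le> m" if "i < n" for i unfolding m_def using that by auto
  have "m \<in> v ` {..<n}" unfolding m_def using i0 by (intro Max_in) auto
  then have lb: "m - eps \<le> v i" if "i < n" "0 < p i" for i using ws that by auto
  define s where "s i = (if 0 < p i then m - eps / 2 - v i else - eps / 2)" for i
  have "(\<Sum>k<n. p k * (v k + s k)) = (\<Sum>k<n. p k * (m - eps / 2))"
    using p by (intro sum.cong) (auto simp: s_def strat_def le_less)
  also have "\<dots> = m - eps / 2" using p by (simp add: strat_def flip: sum_distrib_right)
  finally have avg: "(\<Sum>k<n. p k * (v k + s k)) = m - eps / 2" .
  have "\<bar>s i\<bar> \<le> eps / 2" if "i < n" for i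
    using ub[OF that] lb[OF that] eps by (auto simp: s_def abs_le_iff field_simps)
  moreover have "v i + s i \<le> m - eps / 2" if "i < n" for i
    using ub[OF that] by (auto simp: s_def)
  ultimately show ?thesis using avg by (intro exI[of _ s]) auto
qed

text \<open>A well-supported \<open>eps\<close>-equilibrium is an exact equilibrium of a game with
  payoffs changed by at most \<open>eps / 2\<close>, so one stability notion reduces to the
  other.\<close>

lemma perturb_stable_imp_ws_approx_stable:
  assumes stable: "perturb_stable n R C (eps / 2) Delta" and eps: "0 \<le> eps"
  shows "ws_approx_stable n R C eps Delta"
  unfolding ws_approx_stable_def
proof (intro allI impI)
  fix p q assume ws: "ws_eq n R C eps p q"
  then have p: "strat n p" and q: "strat n q" by (auto simp: ws_eq_def)
  obtain s where s: "\<And>i. i < n \<Longrightarrow> \<bar>s i\<bar> \<le> eps / 2"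
    "\<And>i. i < n \<Longrightarrow> row_val n R q i + s i \<le> (\<Sum>k<n. p k * (row_val n R q k + s k))"
    using ws_best_response_shift[OF p eps, of "row_val n R q"] ws by (auto simp: ws_eq_def)
  obtain t where t: "\<And>i. i < n \<Longrightarrow> \<bar>t i\<bar> \<le> eps / 2"
    "\<And>i. i < n \<Longrightarrow> col_val n C p i + t i \<le> (\<Sum>k<n. q k * (col_val n C p k + t k))"
    using ws_best_response_shift[OF q eps, of "col_val n C p"] ws by (auto simp: ws_eq_def)
  \<comment> \<open>A shift constant along a row of \<open>R\<close> (a column of \<open>C\<close>)
    moves the value of that action by exactly the shift, since the opponent's strategy sums to
    1.\<close>
  define R' where "R' i j = R i j + s i" for i j
  define C' where "C' i j = C i j + t j" for i j
  have "row_val n R' q i = row_val n R q i + s i" for i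
    using q by (simp add: R'_def row_val_def algebra_simps sum.distrib strat_def flip: sum_distrib_right)
  moreover have "col_val n C' p j = col_val n C p j + t j" for j
    using p by (simp add: C'_def col_val_def algebra_simps sum.distrib strat_def flip: sum_distrib_right)
  ultimately have "nash n R' C' p q"
    unfolding nash_def payoff_rows[of n R'] payoff_cols[of n C'] using p q s t by simp
  moreover have "perturbation n R C R' C' (eps / 2)"
    using s t by (simp add: perturbation_def R'_def C'_def)
  ultimately show "\<exists>pq'\<in>nash_set n R C. pdist n (p, q) pq' \<le> Delta"
    using stable by (auto simp: perturb_stable_def nash_set_def)
qed

section \<open>Sampling\<close>

lemma exp_le_quadratic:
  fixes x :: real
  assumes "\<bar>x\<bar> \<le> 1"
  shows "exp x \<le> 1 + x + x\<^sup>2"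
proof (cases "0 \<le> x")
  case True
  then show ?thesis using assms by (intro exp_bound) auto
next
  case False
  define y where "y = - x"
  have y: "0 \<le> y" using False by (simp add: y_def)
  \<comment> \<open>The product is \<open>1 + y ^ 3\<close>.\<close>
  have "1 \<le> (1 + y) * (1 - y + y\<^sup>2)"
    using y by (simp add: algebra_simps power2_eq_square)
  also have "\<dots> \<le> exp y * (1 - y + y\<^sup>2)"
  proof (rule mult_right_mono)
    have "0 \<le> (y - 1/2)\<^sup>2 + 3/4" by simp
    then show "0 \<le> 1 - y + y\<^sup>2" by (simp add: power2_eq_square algebra_simps)
  qed (rule exp_ge_add_one_self)
  finally have "1 / exp y \<le> 1 - y + y\<^sup>2" by (simp add: field_simps)
  then show ?thesis by (simp add: y_def exp_minus inverse_eq_divide)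
qed

text \<open>The estimate behind Hoeffding's bound: in the quadratic bound for \<open>exp\<close> the
  linear term averages to 0 and the squared one to at most \<open>l ^ 2\<close>.\<close>

lemma exp_moment_bound:
  fixes P v :: "'a \<Rightarrow> real" and l :: real
  assumes P0: "\<And>i. i \<in> I \<Longrightarrow> 0 \<le> P i" and P1: "sum P I = 1"
    and v: "\<And>i. i \<in> I \<Longrightarrow> 0 \<le> v i \<and> v i \<le> 1" and l: "\<bar>l\<bar> \<le> 1"
  shows "(\<Sum>i\<in>I. P i * exp (l * (v i - (\<Sum>k\<in>I. P k * v k)))) \<le> exp (l\<^sup>2)"
proof -
  define m where "m = (\<Sum>k\<in>I. P k * v k)"
  have "m \<le> (\<Sum>k\<in>I. P k)" unfolding m_def
    using P0 v by (intro sum_mono) (simp add: mult_left_le)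
  then have m: "0 \<le> m" "m \<le> 1"
    using P0 P1 v by (auto simp: m_def intro!: sum_nonneg)
  have "P i * exp (l * (v i - m)) \<le> P i * (1 + l\<^sup>2) + l * (P i * v i - P i * m)" if "i \<in> I" for i
  proof -
    have d: "\<bar>v i - m\<bar> \<le> 1" using v[OF that] m by auto
    then have "\<bar>l * (v i - m)\<bar> \<le> 1" using l by (simp add: abs_mult mult_le_one)
    then have "exp (l * (v i - m)) \<le> 1 + l * (v i - m) + (l * (v i - m))\<^sup>2"
      by (rule exp_le_quadratic)
    also have "(l * (v i - m))\<^sup>2 \<le> l\<^sup>2 * 1"
      unfolding power_mult_distrib using d by (intro mult_left_mono) (simp_all add: abs_square_le_1)
    finally have "P i * exp (l * (v i - m)) \<le> P i * (1 + l * (v i - m) + l\<^sup>2)"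
      using P0[OF that] by (intro mult_left_mono) auto
    then show ?thesis by (simp add: algebra_simps)
  qed
  then have "(\<Sum>i\<in>I. P i * exp (l * (v i - m)))
      \<le> (\<Sum>i\<in>I. P i * (1 + l\<^sup>2) + l * (P i * v i - P i * m))"
    by (rule sum_mono)
  also have "\<dots> = 1 + l\<^sup>2"
    by (simp add: sum.distrib sum_subtractf P1 flip: sum_distrib_left sum_distrib_right)
       (simp add: m_def)
  also have "\<dots> \<le> exp (l\<^sup>2)" by (rule exp_ge_add_one_self)
  finally show ?thesis by (simp add: m_def)
qed

text \<open>Independence of \<open>S\<close> draws with weights \<open>P\<close>: the average of a
  product is a power of the one-draw average.\<close>

lemma sum_PiE_weighted_prod:
  fixes P f :: "'a \<Rightarrow> real"
  assumes "finite I"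
  shows "(\<Sum>X\<in>PiE {..<S::nat} (\<lambda>_. I). (\<Prod>s<S. P (X s)) * (\<Prod>s<S. f (X s))) = (\<Sum>i\<in>I. P i * f i) ^ S"
  using prod_sum_PiE[of "{..<S}" "\<lambda>_. I" "\<lambda>_ i. P i * f i"] assms
  by (simp add: prod.distrib)

lemma sum_weighted_swap:
  fixes w :: "'a \<Rightarrow> 'c::semiring_0"
  shows "(\<Sum>x\<in>A. w x * (\<Sum>j\<in>J. G j x)) = (\<Sum>j\<in>J. \<Sum>x\<in>A. w x * G j x)"
  unfolding sum_distrib_left by (rule sum.swap)

lemma exists_less_of_weighted_average:
  fixes w F :: "'a \<Rightarrow> real"
  assumes "\<And>x. x \<in> A \<Longrightarrow> 0 \<le> w x" "sum w A = 1" "(\<Sum>x\<in>A. w x * F x) < c"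
  shows "\<exists>x\<in>A. F x < c"
proof (rule ccontr)
  assume "\<not> ?thesis"
  then have "(\<Sum>x\<in>A. w x * c) \<le> (\<Sum>x\<in>A. w x * F x)"
    using assms(1) by (intro sum_mono mult_left_mono) auto
  then show False using assms(2,3) by (simp flip: sum_distrib_right)
qed

text \<open>The probabilistic method without a probability space: the union bound is the statement that
  the weighted average of the potential \<open>F\<close> over all sample sequences is less than 1.\<close>

lemma exists_sample:
  fixes P :: "'a \<Rightarrow> real" and v :: "'j \<Rightarrow> 'a \<Rightarrow> real" and A :: "'k \<Rightarrow> 'a set" and S :: nat
  assumes I: "finite I" and J: "finite J" and K: "finite K"
    and P0: "\<And>i. i \<in> I \<Longrightarrow> 0 \<le> P i" and P1: "sum P I = 1"
    and v: "\<And>j i. j \<in> J \<Longrightarrow> i \<in> I \<Longrightarrow> 0 \<le> v j i \<and> v j i \<le> 1"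
    and A: "\<And>k. k \<in> K \<Longrightarrow> sum P (I \<inter> A k) \<le> 1 / 16"
    and \<tau>: "0 \<le> \<tau>" "\<tau> \<le> 2"
    and less: "2 * real (card J) * exp (- (real S * \<tau>\<^sup>2 / 4)) + real (card K) / 2 ^ S < 1"
  shows "\<exists>X\<in>PiE {..<S} (\<lambda>_. I).
    (\<forall>j\<in>J. \<bar>(\<Sum>s<S. v j (X s)) - real S * (\<Sum>i\<in>I. P i * v j i)\<bar> \<le> real S * \<tau>) \<and>
    (\<forall>k\<in>K. 2 * card {s. s < S \<and> X s \<in> A k} < S)"
proof -
  define mu where "mu j = (\<Sum>i\<in>I. P i * v j i)" for j
  \<comment> \<open>With \<open>l\<close> equal to plus or minus \<open>\<tau> / 2\<close>,
    \<open>E\<close> is at least 1 once the sample sum errs by \<open>S * \<tau>\<close> in that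
    direction. Its average is small because the exponential moments use up only half of the exponent
    in the prefactor.\<close>
  define E where "E l j X = exp (- (real S * \<tau>\<^sup>2 / 2)) * (\<Prod>s<S. exp (l * (v j (X s) - mu j)))"
    for l j and X :: "nat \<Rightarrow> 'a"
  \<comment> \<open>A draw in \<open>A k\<close> counts 16 against the 4 divided out per draw, so
    \<open>H\<close> is at least 1 once half of the draws hit. One draw averages to at most (1 +
    15/16) / 4, which is below 1/2.\<close>
  define H where "H k X = (1 / 4) ^ S * (\<Prod>s<S. if X s \<in> A k then 16 else 1 :: real)"
    for k and X :: "nat \<Rightarrow> 'a"
  define F where "F X = (\<Sum>j\<in>J. E (\<tau> / 2) j X) + (\<Sum>j\<in>J. E (- \<tau> / 2) j X) + (\<Sum>k\<in>K. H k X)" for X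
  define w where "w X = (\<Prod>s<S. P (X s))" for X
  let ?\<Omega> = "PiE {..<S} (\<lambda>_. I)"
  have avgE: "(\<Sum>X\<in>?\<Omega>. w X * E l j X) \<le> exp (- (real S * \<tau>\<^sup>2 / 4))"
    if "j \<in> J" "\<bar>l\<bar> = \<tau> / 2" for l j
  proof -
    have "(\<Sum>X\<in>?\<Omega>. w X * E l j X) = exp (- (real S * \<tau>\<^sup>2 / 2)) *
        (\<Sum>X\<in>?\<Omega>. (\<Prod>s<S. P (X s)) * (\<Prod>s<S. exp (l * (v j (X s) - mu j))))"
      by (simp add: w_def E_def sum_distrib_left mult_ac)
    also have "\<dots> = exp (- (real S * \<tau>\<^sup>2 / 2)) * (\<Sum>i\<in>I. P i * exp (l * (v j i - mu j))) ^ S"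
      by (simp only: sum_PiE_weighted_prod[OF I, of P S "\<lambda>i. exp (l * (v j i - mu j))"])
    also have "\<dots> \<le> exp (- (real S * \<tau>\<^sup>2 / 2)) * exp (l\<^sup>2) ^ S"
      unfolding mu_def using that \<tau> P0 P1 v
      by (intro mult_left_mono power_mono exp_moment_bound sum_nonneg) auto
    also have "l\<^sup>2 = (\<tau> / 2)\<^sup>2" using that(2) by (metis power2_abs)
    finally show ?thesis by (simp add: power_divide flip: exp_of_nat_mult exp_add)
  qed
  have avgH: "(\<Sum>X\<in>?\<Omega>. w X * H k X) \<le> 1 / 2 ^ S" if "k \<in> K" for k
  proof -
    let ?h = "\<lambda>i. if i \<in> A k then 16 else 1 :: real"
    have "(\<Sum>i\<in>I. P i * ?h i) = (\<Sum>i\<in>I. P i + (if i \<in> A k then 15 * P i else 0))"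
      by (intro sum.cong) auto
    also have "\<dots> = 1 + 15 * sum P (I \<inter> A k)"
      by (simp add: sum.distrib P1 sum.inter_restrict[OF I] sum_distrib_left if_distrib[of "(*) 15"] cong: if_cong)
    also have "\<dots> \<le> 2" using A[OF that] by simp
    finally have le: "(\<Sum>i\<in>I. P i * ?h i) \<le> 2" .
    have "(\<Sum>X\<in>?\<Omega>. w X * H k X) = (1 / 4) ^ S * (\<Sum>X\<in>?\<Omega>. (\<Prod>s<S. P (X s)) * (\<Prod>s<S. ?h (X s)))"
      by (simp add: w_def H_def sum_distrib_left mult_ac)
    also have "\<dots> = (1 / 4) ^ S * (\<Sum>i\<in>I. P i * ?h i) ^ S"
      by (simp only: sum_PiE_weighted_prod[OF I, of P S ?h])
    also have "\<dots> \<le> (1 / 4) ^ S * 2 ^ S"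
      using le P0 by (intro mult_left_mono power_mono sum_nonneg) auto
    also have "\<dots> = (1 / 4 * 2) ^ S" by (rule power_mult_distrib[symmetric])
    also have "\<dots> = 1 / 2 ^ S" by (simp add: power_one_over)
    finally show ?thesis .
  qed
  have "(\<Sum>X\<in>?\<Omega>. w X * F X) = (\<Sum>j\<in>J. \<Sum>X\<in>?\<Omega>. w X * E (\<tau> / 2) j X)
      + (\<Sum>j\<in>J. \<Sum>X\<in>?\<Omega>. w X * E (- \<tau> / 2) j X) + (\<Sum>k\<in>K. \<Sum>X\<in>?\<Omega>. w X * H k X)"
    by (simp add: F_def distrib_left sum.distrib sum_weighted_swap)
  also have "\<dots> \<le> (\<Sum>j\<in>J. exp (- (real S * \<tau>\<^sup>2 / 4))) + (\<Sum>j\<in>J. exp (- (real S * \<tau>\<^sup>2 / 4)))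
      + (\<Sum>k\<in>K. 1 / 2 ^ S)"
    using \<tau> by (intro add_mono sum_mono avgE avgH) auto
  also have "\<dots> < 1" using less by simp
  finally have avg: "(\<Sum>X\<in>?\<Omega>. w X * F X) < 1" .
  have "sum w ?\<Omega> = 1"
    using sum_PiE_weighted_prod[OF I, where f = "\<lambda>_. 1" and S = S and P = P] by (simp add: w_def P1)
  moreover have "0 \<le> w X" if "X \<in> ?\<Omega>" for X
    unfolding w_def using that by (intro prod_nonneg P0) auto
  ultimately obtain X where X: "X \<in> ?\<Omega>" "F X < 1"
    using exists_less_of_weighted_average[OF _ _ avg] by blast
  \<comment> \<open>All terms of \<open>F\<close> are nonnegative, so each of them is below 1 at
    \<open>X\<close>: no bad event occurs.\<close>
  have E0: "0 \<le> E l j X" and H0: "0 \<le> H k X" for l j k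
    by (auto simp: E_def H_def intro!: mult_nonneg_nonneg prod_nonneg)
  have sums: "0 \<le> (\<Sum>j\<in>J. E l j X)" "0 \<le> (\<Sum>k\<in>K. H k X)" for l
    by (auto intro!: sum_nonneg E0 H0)
  have E_lt: "E (\<tau> / 2) j X < 1" "E (- \<tau> / 2) j X < 1" if "j \<in> J" for j
    using member_le_sum[of j J "\<lambda>j. E (\<tau> / 2) j X"] member_le_sum[of j J "\<lambda>j. E (- \<tau> / 2) j X"]
      that E0 J X(2) sums(2) sums(1)[of "\<tau> / 2"] sums(1)[of "- \<tau> / 2"] unfolding F_def by fastforce+
  have H_lt: "H k X < 1" if "k \<in> K" for k
    using member_le_sum[of k K "\<lambda>k. H k X"] that H0 K X(2) sums(1)[of "\<tau> / 2"] sums(1)[of "- \<tau> / 2"] unfolding F_def by fastforce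
  have E_eq: "E l j X = exp (l * ((\<Sum>s<S. v j (X s)) - real S * mu j) - real S * \<tau>\<^sup>2 / 2)" for l j
  proof -
    have "(\<Prod>s<S. exp (l * (v j (X s) - mu j))) = exp (l * ((\<Sum>s<S. v j (X s)) - real S * mu j))"
      by (simp add: sum_subtractf flip: exp_sum sum_distrib_left)
    then show ?thesis by (simp add: E_def flip: exp_add)
  qed
  have "\<bar>(\<Sum>s<S. v j (X s)) - real S * mu j\<bar> \<le> real S * \<tau>" if "j \<in> J" for j
  proof (rule ccontr)
    define D where "D = (\<Sum>s<S. v j (X s)) - real S * mu j"
    assume "\<not> \<bar>(\<Sum>s<S. v j (X s)) - real S * mu j\<bar> \<le> real S * \<tau>"
    then have "real S * \<tau> \<le> D \<or> real S * \<tau> \<le> - D" by (auto simp: D_def)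
    then have "\<tau> / 2 * (real S * \<tau>) \<le> \<tau> / 2 * D \<or> \<tau> / 2 * (real S * \<tau>) \<le> \<tau> / 2 * (- D)"
      using \<tau> by (meson divide_nonneg_nonneg mult_left_mono zero_le_numeral)
    then have "1 \<le> E (\<tau> / 2) j X \<or> 1 \<le> E (- \<tau> / 2) j X"
      unfolding E_eq D_def[symmetric] by (auto simp: power2_eq_square algebra_simps)
    then show False using E_lt[OF that] by linarith
  qed
  moreover have "2 * card {s. s < S \<and> X s \<in> A k} < S" if "k \<in> K" for k
  proof (rule ccontr)
    define c where "c = card {s. s < S \<and> X s \<in> A k}"
    assume "\<not> 2 * card {s. s < S \<and> X s \<in> A k} < S"
    then have "(4::real) ^ S \<le> 4 ^ (2 * c)" by (intro power_increasing) (auto simp: c_def)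
    also have "\<dots> = 16 ^ c" by (simp add: power_mult)
    also have "\<dots> = (\<Prod>s\<in>{..<S} \<inter> {s. X s \<in> A k}. 16)"
      by (simp add: c_def Int_def)
    also have "\<dots> = (\<Prod>s<S. if X s \<in> A k then 16 else 1)"
      by (subst prod.inter_restrict) auto
    finally have "1 \<le> H k X" by (simp add: H_def field_simps)
    then show False using H_lt[OF that] by simp
  qed
  ultimately show ?thesis using X(1) unfolding mu_def by blast
qed

section \<open>Resampling a part of a strategy\<close>

lemma exists_top_subset:
  fixes p :: "'a \<Rightarrow> real"
  assumes "finite A" "k \<le> card A"
  shows "\<exists>D\<subseteq>A. card D = k \<and> (\<forall>i\<in>A - D. \<forall>l\<in>D. p i \<le> p l)"
  using assms(2)
proof (induction k)
  case 0
  then show ?case by (intro exI[of _ "{}"]) auto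
next
  case (Suc k)
  then obtain D where D: "D \<subseteq> A" "card D = k" "\<forall>i\<in>A - D. \<forall>l\<in>D. p i \<le> p l" by auto
  have fin: "finite (A - D)" "finite D" using assms(1) D(1) finite_subset by auto
  have "A - D \<noteq> {}" using D Suc.prems fin by (metis Diff_eq_empty_iff card_mono not_less_eq_eq)
  then obtain i where i: "i \<in> A - D" "p i = Max (p ` (A - D))"
    using Max_in[of "p ` (A - D)"] fin by fastforce
  have "p i' \<le> p i" if "i' \<in> A - D" for i' using i(2) that fin by auto
  then show ?case
    using D i fin by (intro exI[of _ "insert i D"]) auto
qed

text \<open>Induction on the rounds, each of which moves the \<open>Q\<close> heaviest remaining
  atoms into \<open>B\<close>. A set that already meets the bounds of the next round is kept as it
  is.\<close>

lemma concentrated_or_spread: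
  fixes p :: "'a \<Rightarrow> real"
  assumes fin: "finite A" and p0: "\<And>i. i \<in> A \<Longrightarrow> 0 \<le> p i" and p1: "sum p A = 1"
  shows "\<exists>B\<subseteq>A. (card B \<le> Q * j \<and> sum p (A - B) \<le> max m ((1 / 2) ^ j)) \<or>
    (m \<le> sum p (A - B) \<and> (\<forall>i\<in>A - B. real Q * p i \<le> sum p (A - B)))"
proof (induction j)
  case 0
  then show ?case using p1 by (intro exI[of _ "{}"]) auto
next
  case (Suc j)
  let ?goal = "\<lambda>B. (card B \<le> Q * Suc j \<and> sum p (A - B) \<le> max m ((1 / 2) ^ Suc j)) \<or>
    (m \<le> sum p (A - B) \<and> (\<forall>i\<in>A - B. real Q * p i \<le> sum p (A - B)))"
  obtain B where B: "B \<subseteq> A" and IH: "(card B \<le> Q * j \<and> sum p (A - B) \<le> max m ((1 / 2) ^ j)) \<or>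
    (m \<le> sum p (A - B) \<and> (\<forall>i\<in>A - B. real Q * p i \<le> sum p (A - B)))"
    using Suc.IH by blast
  have finB: "finite B" "finite (A - B)" using B fin finite_subset by auto
  show ?case
  proof (cases "?goal B")
    case True
    then show ?thesis using B by blast
  next
    case False
    then have cB: "card B \<le> Q * j" and t: "sum p (A - B) \<le> max m ((1 / 2) ^ j)"
      using IH by blast+
    have tm: "m < sum p (A - B)" using False cB by (auto simp: not_le)
    have tj: "sum p (A - B) \<le> (1 / 2) ^ j" using t tm by auto
    show ?thesis
    proof (cases "Q \<le> card (A - B)")
      case False
      have "card A = card B + card (A - B)"
        using B finB by (metis card_Diff_subset card_mono fin le_add_diff_inverse)
      \<comment> \<open>Fewer than \<open>Q\<close> atoms remain, so one round takes them
        all.\<close>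
      then have "?goal A" using False cB by (simp add: le_max_iff_disj)
      then show ?thesis by blast
    next
      case True
      then obtain D where D: "D \<subseteq> A - B" "card D = Q" "\<forall>i\<in>A - B - D. \<forall>l\<in>D. p i \<le> p l"
        using exists_top_subset[OF finB(2), of Q p] by blast
      have diff: "A - (B \<union> D) = A - B - D" by auto
      have split: "sum p (A - B) = sum p D + sum p (A - (B \<union> D))"
        unfolding diff using sum.subset_diff[OF D(1) finB(2), of p] by simp
      have "card (B \<union> D) \<le> Q * Suc j"
        using card_Un_le[of B D] cB D(2) by simp
      moreover have "real Q * p i \<le> sum p D" if "i \<in> A - (B \<union> D)" for i
        using sum_bounded_below[of D "p i" p] D(2,3) that by auto
      moreover have "sum p (A - (B \<union> D)) \<le> (1 / 2) ^ Suc j" if "sum p (A - (B \<union> D)) \<le> sum p D"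
        using that split tj by simp
      \<comment> \<open>Every remaining atom is at most the average over \<open>D\<close>. If
        \<open>D\<close> weighs at least as much as the rest, the mass is halved; otherwise the rest
        is spread, or weighs less than \<open>m\<close>.\<close>
      ultimately have "?goal (B \<union> D)"
        by (smt (verit) max.cobounded1 max.cobounded2)
      moreover have "B \<union> D \<subseteq> A" using B D by auto
      ultimately show ?thesis by blast
    qed
  qed
qed

section \<open>The resampled strategy\<close>

text \<open>The part \<open>m * P\<close> of \<open>p\<close> is exchanged for \<open>m\<close>
  times the empirical measure of the draws with index below \<open>S\<close>.\<close>

definition resample :: "(nat \<Rightarrow> real) \<Rightarrow> (nat \<Rightarrow> real) \<Rightarrow> real \<Rightarrow> nat \<Rightarrow> (nat \<Rightarrow> nat) \<Rightarrow> nat \<Rightarrow> real" where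
  "resample p P m S X i = p i - m * P i + m / real S * real (card {s. s < S \<and> X s = i})"

lemma sum_fibre_card:
  fixes f :: "nat \<Rightarrow> real" and S :: nat
  assumes "\<And>s. s < S \<Longrightarrow> X s < n"
  shows "(\<Sum>i<n. real (card {s. s < S \<and> X s = i}) * f i) = (\<Sum>s<S. f (X s))"
proof -
  have "real (card {s. s < S \<and> X s = i}) * f i = (\<Sum>s<S. if i = X s then f i else 0)" for i
  proof -
    have "{s. s < S \<and> X s = i} = {s \<in> {..<S}. i = X s}" by auto
    then have "real (card {s. s < S \<and> X s = i}) * f i = (\<Sum>s\<in>{s \<in> {..<S}. i = X s}. f i)"
      by (simp only: sum_constant)
    also have "\<dots> = (\<Sum>s<S. if i = X s then f i else 0)" by (rule sum.inter_filter) simp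
    finally show ?thesis .
  qed
  then have "(\<Sum>i<n. real (card {s. s < S \<and> X s = i}) * f i) = (\<Sum>s<S. \<Sum>i<n. if i = X s then f i else 0)"
    by (simp only:) (rule sum.swap)
  also have "\<dots> = (\<Sum>s<S. f (X s))" using assms by (intro sum.cong) (auto simp: sum.delta)
  finally show ?thesis .
qed

lemma sum_resample:
  fixes f :: "nat \<Rightarrow> real"
  assumes "\<And>s. s < S \<Longrightarrow> X s < n"
  shows "(\<Sum>i<n. resample p P m S X i * f i) =
    (\<Sum>i<n. p i * f i) - m * (\<Sum>i<n. P i * f i) + m / real S * (\<Sum>s<S. f (X s))"
proof -
  have "(\<Sum>i<n. resample p P m S X i * f i) = (\<Sum>i<n. p i * f i) - m * (\<Sum>i<n. P i * f i)
    + m / real S * (\<Sum>i<n. real (card {s. s < S \<and> X s = i}) * f i)"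
    by (simp add: resample_def algebra_simps sum.distrib sum_subtractf sum_distrib_left)
  then show ?thesis by (simp add: sum_fibre_card[OF assms])
qed

lemma strat_resample:
  assumes p: "strat n p" and P: "strat n P" and m: "0 \<le> m" and le: "\<And>i. i < n \<Longrightarrow> m * P i \<le> p i"
    and S: "0 < S" and X: "\<And>s. s < S \<Longrightarrow> X s < n"
  shows "strat n (resample p P m S X)"
  unfolding strat_def
proof (intro conjI allI impI)
  show "0 \<le> resample p P m S X i" if "i < n" for i
    using le[OF that] m by (simp add: resample_def)
  show "resample p P m S X i = 0" if "n \<le> i" for i
  proof -
    have "{s. s < S \<and> X s = i} = {}" using X that by force
    then show ?thesis using p P that by (simp only: resample_def) (simp add: strat_def)
  qed
  show "(\<Sum>i<n. resample p P m S X i) = 1"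
    using sum_resample[of S X n p P m "\<lambda>_. 1"] X p P S by (simp add: strat_def)
qed

text \<open>Where \<open>p\<close> vanishes so does \<open>P\<close>, hence no draw lands there.
  This containment keeps played actions best responses to the opponent.\<close>

lemma resample_pos_imp_pos:
  assumes p: "strat n p" and P: "strat n P" and m: "0 < m" and le: "\<And>i. i < n \<Longrightarrow> m * P i \<le> p i"
    and X: "\<And>s. s < S \<Longrightarrow> X s < n \<and> 0 < P (X s)" and pos: "0 < resample p P m S X i"
  shows "0 < p i"
proof (rule ccontr)
  assume "\<not> 0 < p i"
  then have p0: "p i = 0" using p by (cases "i < n") (force simp: strat_def)+
  have P0: "P i = 0"
  proof (cases "i < n")
    case True
    then have "0 \<le> P i" "m * P i \<le> 0" using P le[of i] p0 by (auto simp: strat_def)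
    then show ?thesis using m by (simp add: mult_le_0_iff)
  qed (use P in \<open>simp add: strat_def\<close>)
  then have "{s. s < S \<and> X s = i} = {}" using X by force
  then show False using pos p0 P0 by (simp only: resample_def) simp
qed

text \<open>A column payoff changes by \<open>m / S\<close> times the deviation of the sampled
  column entries from their mean, which \<open>exists_sample\<close> bounds by
  \<open>S * \<tau>\<close>.\<close>

lemma exists_resample:
  fixes C :: "nat \<Rightarrow> nat \<Rightarrow> real" and A :: "'k \<Rightarrow> nat set"
  assumes p: "strat n p" and P: "strat n P" and m: "0 < m" and le: "\<And>i. i < n \<Longrightarrow> m * P i \<le> p i"
    and C: "\<And>i j. i < n \<Longrightarrow> j < n \<Longrightarrow> 0 \<le> C i j \<and> C i j \<le> 1" and S: "0 < S"
    and K: "finite K" and A: "\<And>k. k \<in> K \<Longrightarrow> sum P ({..<n} \<inter> A k) \<le> 1 / 16"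
    and \<tau>: "0 \<le> \<tau>" "\<tau> \<le> 2"
    and less: "2 * real n * exp (- (real S * \<tau>\<^sup>2 / 4)) + real (card K) / 2 ^ S < 1"
  shows "\<exists>X. (\<forall>s<S. X s < n) \<and> strat n (resample p P m S X) \<and>
    (\<forall>i. 0 < resample p P m S X i \<longrightarrow> 0 < p i) \<and>
    (\<forall>j<n. \<bar>col_val n C (resample p P m S X) j - col_val n C p j\<bar> \<le> m * \<tau>) \<and>
    (\<forall>k\<in>K. 2 * card {s. s < S \<and> X s \<in> A k} < S)"
proof -
  \<comment> \<open>Draws come only from atoms of positive mass, as the support condition
    requires.\<close>
  define I where "I = {i. i < n \<and> 0 < P i}"
  have PI: "P i = 0" if "i \<in> {..<n} - I" for i
    using P that by (force simp: I_def strat_def not_less)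
  have I: "I \<subseteq> {..<n}" "finite I" by (auto simp: I_def)
  have sumI: "(\<Sum>i\<in>I. P i * f i) = (\<Sum>i<n. P i * f i)" for f
    by (rule sum.mono_neutral_left) (use I PI in auto)
  have "\<exists>X\<in>PiE {..<S} (\<lambda>_. I).
    (\<forall>j\<in>{..<n}. \<bar>(\<Sum>s<S. C (X s) j) - real S * (\<Sum>i\<in>I. P i * C i j)\<bar> \<le> real S * \<tau>) \<and>
    (\<forall>k\<in>K. 2 * card {s. s < S \<and> X s \<in> A k} < S)"
  proof (rule exists_sample[OF I(2) finite_lessThan K, where v = "\<lambda>j i. C i j"])
    show "sum P I = 1" using sumI[of "\<lambda>_. 1"] P by (simp add: strat_def)
    show "sum P (I \<inter> A k) \<le> 1 / 16" if "k \<in> K" for k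
    proof -
      have "sum P (I \<inter> A k) \<le> sum P ({..<n} \<inter> A k)"
        using I P by (intro sum_mono2) (auto simp: strat_def)
      then show ?thesis using A[OF that] by simp
    qed
  qed (use C \<tau> less I in \<open>auto simp: I_def\<close>)
  then obtain X where XI: "X \<in> PiE {..<S} (\<lambda>_. I)"
    and dev: "\<And>j. j < n \<Longrightarrow> \<bar>(\<Sum>s<S. C (X s) j) - real S * (\<Sum>i<n. P i * C i j)\<bar> \<le> real S * \<tau>"
    and XA: "\<forall>k\<in>K. 2 * card {s. s < S \<and> X s \<in> A k} < S"
    unfolding sumI by blast
  have X: "X s < n \<and> 0 < P (X s)" if "s < S" for s
    using XI that by (auto simp: I_def dest!: PiE_mem)
  have "\<bar>col_val n C (resample p P m S X) j - col_val n C p j\<bar> \<le> m * \<tau>" if "j < n" for j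
  proof -
    have "col_val n C (resample p P m S X) j - col_val n C p j =
        m / real S * ((\<Sum>s<S. C (X s) j) - real S * (\<Sum>i<n. P i * C i j))"
      unfolding col_val_def using X S by (subst sum_resample) (auto simp: field_simps)
    also have "\<bar>\<dots>\<bar> \<le> m / real S * (real S * \<tau>)"
      unfolding abs_mult using dev[OF that] m by (intro mult_mono) auto
    finally show ?thesis using S by simp
  qed
  then show ?thesis
    using XA X strat_resample[OF p P _ le S, of X] resample_pos_imp_pos[OF p P m le, of S X] m
    by (intro exI[of _ X]) auto
qed

text \<open>\<open>A\<close> depends on \<open>r\<close> but not on \<open>X\<close>, so it can be
  fixed before sampling. A resampled strategy near \<open>r\<close> forces half of the draws into
  \<open>A\<close>, although \<open>A\<close> has small \<open>P\<close>-mass.\<close>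

lemma resample_near_imp_hits:
  fixes r p P :: "nat \<Rightarrow> real" and m :: real and S :: nat
  defines "A \<equiv> {i. m / (2 * real S) \<le> r i - p i + m * P i}"
  assumes P: "strat n P" and spread: "\<And>i. i < n \<Longrightarrow> 40 * real S * P i \<le> 1"
    and m: "0 < m" and S: "0 < S" and X: "\<And>s. s < S \<Longrightarrow> X s < n"
    and near: "sdist n (resample p P m S X) r \<le> m / 8"
  shows "sum P ({..<n} \<inter> A) \<le> 1 / 16 \<and> S \<le> 2 * card {s. s < S \<and> X s \<in> A}"
proof -
  \<comment> \<open>\<open>w\<close> is what the sampled part \<open>nu\<close> would be if the
    resampled strategy equalled \<open>r\<close>. Nearness bounds their l1 distance by
    \<open>m / 4\<close>, as \<open>sdist\<close> is half of it.\<close>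
  define w where "w i = r i - p i + m * P i" for i
  define nu where "nu i = m / real S * real (card {s. s < S \<and> X s = i})" for i
  have A: "i \<in> A \<longleftrightarrow> m / (2 * real S) \<le> w i" for i by (simp add: A_def w_def)
  have nu0: "0 \<le> nu i" for i using m by (simp add: nu_def)
  have d: "(\<Sum>i<n. \<bar>nu i - w i\<bar>) \<le> m / 4"
    using near by (simp add: sdist_def resample_def nu_def w_def algebra_simps)
  have sum_nu: "(\<Sum>i<n. nu i * f i) = m / real S * (\<Sum>s<S. f (X s))" for f
    using sum_fibre_card[of S X n f] X by (simp only: nu_def mult.assoc flip: sum_distrib_left)
  \<comment> \<open>On \<open>A\<close>, half the mass \<open>m / S\<close> of one draw is at most
    \<open>w\<close>, hence at most \<open>nu + |nu - w|\<close>, whose total is at most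
    \<open>5 * m / 4\<close>.\<close>
  have "real (card ({..<n} \<inter> A)) * (m / (2 * real S)) = (\<Sum>i\<in>{..<n} \<inter> A. m / (2 * real S))"
    by simp
  also have "\<dots> \<le> (\<Sum>i\<in>{..<n} \<inter> A. nu i + \<bar>nu i - w i\<bar>)"
    using A by (intro sum_mono) (auto intro: order_trans)
  also have "\<dots> \<le> (\<Sum>i<n. nu i + \<bar>nu i - w i\<bar>)"
    using nu0 by (intro sum_mono2) auto
  also have "\<dots> \<le> m + m / 4"
    using d sum_nu[of "\<lambda>_. 1"] S by (simp add: sum.distrib)
  finally have cardA: "real (card ({..<n} \<inter> A)) \<le> 5 / 2 * real S"
    using m S by (simp add: field_simps)
  have "sum P ({..<n} \<inter> A) \<le> (\<Sum>i\<in>{..<n} \<inter> A. 1 / (40 * real S))"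
    using spread S by (intro sum_mono) (auto simp: field_simps)
  also have "\<dots> \<le> 1 / 16" using cardA S by (simp add: field_simps)
  finally have "sum P ({..<n} \<inter> A) \<le> 1 / 16" .
  moreover have "S \<le> 2 * card {s. s < S \<and> X s \<in> A}"
  proof -
    \<comment> \<open>Outside \<open>A\<close> a drawn point has \<open>nu\<close> at least
      \<open>m / S\<close>, more than twice \<open>w\<close>. Half of its sampled mass thus counts
      toward the l1 distance, so at most half of the draws lie outside \<open>A\<close>.\<close>
    have half: "nu i / 2 \<le> \<bar>nu i - w i\<bar>" if "i \<notin> A" for i
    proof (cases "nu i = 0")
      case False
      then have "card {s. s < S \<and> X s = i} \<noteq> 0" unfolding nu_def by (intro notI) simp
      then have "1 \<le> real (card {s. s < S \<and> X s = i})" by linarith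
      then have "m / real S * 1 \<le> nu i" unfolding nu_def using m by (intro mult_left_mono) auto
      then have "m / real S \<le> nu i" by simp
      moreover have "2 * w i < m / real S" using that A S by (simp add: not_le field_simps)
      ultimately show ?thesis by linarith
    qed simp
    have "m / real S * real (card {s. s < S \<and> X s \<notin> A}) = (\<Sum>i<n. nu i * (if i \<notin> A then 1 else 0))"
    proof -
      have "{s. s < S \<and> X s \<notin> A} = {..<S} \<inter> {s. X s \<notin> A}" by auto
      then show ?thesis unfolding sum_nu by (simp add: sum.If_cases)
    qed
    also have "\<dots> \<le> (\<Sum>i<n. 2 * \<bar>nu i - w i\<bar>)"
      using half by (intro sum_mono) fastforce
    also have "\<dots> \<le> m / 2" using d by (simp flip: sum_distrib_left)
    finally have "2 * real (card {s. s < S \<and> X s \<notin> A}) \<le> real S" using m S by (simp add: field_simps)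
    moreover have "card {s. s < S \<and> X s \<in> A} + card {s. s < S \<and> X s \<notin> A} = S"
    proof -
      have "{s. s < S \<and> X s \<in> A} \<union> {s. s < S \<and> X s \<notin> A} = {..<S}" by auto
      then show ?thesis by (subst card_Un_disjoint[symmetric]) auto
    qed
    ultimately show ?thesis by linarith
  qed
  ultimately show ?thesis by simp
qed

section \<open>Sparse well-supported equilibria\<close>

lemma ln_2_ge_half: "1 / 2 \<le> ln (2::real)"
  using ln2_ge_two_thirds by simp

text \<open>The factor 1024 is \<open>4 * 16 ^ 2\<close>: for deviation \<open>1 / (16 * k)\<close>
  it brings the Hoeffding exponent to at least \<open>ln (4 * n)\<close>. The second and third
  bounds serve the two halves of the union bound, over columns and over equilibrium
  strategies.\<close>

lemma sample_size_bounds: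
  fixes n :: nat and k :: real
  assumes n: "2 \<le> n" and k: "1 \<le> k"
  defines "S \<equiv> nat \<lceil>1024 * k\<^sup>2 * ln (4 * real n)\<rceil>"
  shows "0 < S" and "2 * real n * exp (- (real S * (1 / (16 * k))\<^sup>2 / 4)) \<le> 1 / 2"
    and "2 * real n powr (k\<^sup>2) < 2 ^ S" and "real S \<le> 3074 * k\<^sup>2 * ln (real n)"
proof -
  let ?x = "1024 * k\<^sup>2 * ln (4 * real n)"
  have k2: "1 \<le> k\<^sup>2" using k by simp
  have lnn: "1 / 2 \<le> ln (real n)"
    by (rule order_trans[OF ln_2_ge_half]) (use n in simp)
  have ln4n: "ln (4 * real n) = ln 4 + ln (real n)" using n by (simp add: ln_mult)
  have ln4: "ln 4 = 2 * ln (2::real)" using ln_realpow[of 2 2] by simp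
  have ln2n: "ln 2 \<le> ln (real n)" using n by simp
  have x0: "0 < ?x" using k2 lnn ln4n ln4 ln_2_ge_half by (intro mult_pos_pos) auto
  then show S0: "0 < S" by (simp add: S_def)
  have S: "?x \<le> real S" "real S \<le> ?x + 1"
    using x0 by (auto simp: S_def)
  have "ln (4 * real n) = ?x * (1 / (16 * k))\<^sup>2 / 4"
    using k by (simp add: field_simps power2_eq_square)
  also have "\<dots> \<le> real S * (1 / (16 * k))\<^sup>2 / 4"
    using S(1) by (intro divide_right_mono mult_right_mono) auto
  finally have "exp (- (real S * (1 / (16 * k))\<^sup>2 / 4)) \<le> exp (- ln (4 * real n))" by simp
  also have "\<dots> = 1 / (4 * real n)" using n by (simp add: exp_minus field_simps)
  finally have "exp (- (real S * (1 / (16 * k))\<^sup>2 / 4)) \<le> 1 / (4 * real n)" .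
  then have "2 * real n * exp (- (real S * (1 / (16 * k))\<^sup>2 / 4)) \<le> 2 * real n * (1 / (4 * real n))"
    by (intro mult_left_mono) auto
  then show "2 * real n * exp (- (real S * (1 / (16 * k))\<^sup>2 / 4)) \<le> 1 / 2" using n by simp
  have "ln 2 + k\<^sup>2 * ln (real n) < k\<^sup>2 * ln 4 + k\<^sup>2 * ln (real n)"
    using k2 ln4 ln_2_ge_half mult_right_mono[OF k2, of "ln 4"] by simp
  also have "\<dots> = ?x * (1 / 1024)" unfolding ln4n by (simp add: algebra_simps)
  also have "\<dots> \<le> ?x * ln 2" using x0 ln_2_ge_half by (intro mult_left_mono) auto
  also have "\<dots> \<le> real S * ln 2" using S(1) by (intro mult_right_mono) auto
  finally have "exp (ln 2 + k\<^sup>2 * ln (real n)) < exp (real S * ln 2)" by simp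
  then show "2 * real n powr (k\<^sup>2) < 2 ^ S"
    using n by (simp add: exp_add powr_def exp_of_nat_mult)
  \<comment> \<open>As \<open>ln 4\<close> is at most \<open>2 * ln n\<close>, the logarithm at most
    triples; the remaining 2 in 3074 = 3 * 1024 + 2 pays for rounding up.\<close>
  have "?x \<le> 1024 * k\<^sup>2 * (3 * ln (real n))"
    using ln4n ln4 ln2n by (intro mult_left_mono) auto
  moreover have "1 \<le> k\<^sup>2 * (2 * ln (real n))"
    using mult_mono[OF k2, of 1 "2 * ln (real n)"] lnn by simp
  ultimately show "real S \<le> 3074 * k\<^sup>2 * ln (real n)" using S(2) by linarith
qed

text \<open>The summand 1 keeps the logarithm at least 1 even for \<open>\<Delta> = 1\<close>, so
  rounding up at most doubles it; the change of base costs at most another factor 2.\<close>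

lemma halving_rounds_bounds:
  fixes \<Delta> :: real
  assumes \<Delta>: "0 < \<Delta>" "\<Delta> \<le> 1"
  defines "L \<equiv> nat \<lceil>log 2 (1 + 1 / \<Delta>)\<rceil>"
  shows "1 \<le> L" and "(1 / 2) ^ L \<le> \<Delta>" and "real L \<le> 4 * ln (1 + 1 / \<Delta>)"
proof -
  have "1 \<le> 1 / \<Delta>" using \<Delta> by simp
  then have log1: "1 \<le> log 2 (1 + 1 / \<Delta>)" by (subst le_log_iff) auto
  then have L: "log 2 (1 + 1 / \<Delta>) \<le> real L" "real L \<le> log 2 (1 + 1 / \<Delta>) + 1"
    by (auto simp: L_def)
  then show "1 \<le> L" using log1 by linarith
  have "1 / \<Delta> \<le> 2 powr (log 2 (1 + 1 / \<Delta>))" using \<Delta> by (simp add: add_pos_pos)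
  also have "\<dots> \<le> 2 powr real L" using L(1) by (intro powr_mono) auto
  finally have "1 / \<Delta> \<le> 2 ^ L" by (simp add: powr_realpow)
  then show "(1 / 2) ^ L \<le> \<Delta>" using \<Delta> by (simp add: power_one_over field_simps)
  have ln0: "0 \<le> ln (1 + 1 / \<Delta>)" using \<Delta> by simp
  have "log 2 (1 + 1 / \<Delta>) \<le> 2 * ln (1 + 1 / \<Delta>)"
    using mult_left_mono[OF ln_2_ge_half ln0] ln_2_ge_half by (simp add: log_def field_simps)
  then show "real L \<le> 4 * ln (1 + 1 / \<Delta>)" using L(2) log1 by linarith
qed

section \<open>Sparse approximation of one player's strategy\<close>

lemma strat_conditional:
  assumes p: "strat n p" and B: "B \<subseteq> {..<n}" and t: "0 < sum p ({..<n} - B)"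
  shows "strat n (\<lambda>i. if i \<in> B then 0 else p i / sum p ({..<n} - B))"
  unfolding strat_def
proof (intro conjI allI impI)
  have "(\<Sum>i<n. if i \<in> B then 0 else p i / sum p ({..<n} - B))
      = (\<Sum>i\<in>{..<n} - B. p i / sum p ({..<n} - B))"
    by (rule sum.mono_neutral_cong_right) auto
  also have "\<dots> = 1" using t by (simp flip: sum_divide_distrib)
  finally show "(\<Sum>i<n. if i \<in> B then 0 else p i / sum p ({..<n} - B)) = 1" .
qed (use p t in \<open>auto simp: strat_def\<close>)

text \<open>\<open>N\<close> stands for this player's equilibrium strategies; transposing the game
  serves the other player. The concentrated alternative gives the sparse strategy, the spread one
  contradicts \<open>stable\<close>.\<close>

lemma sparse_approximation:
  fixes n :: nat and eps \<Delta> :: real and C :: "nat \<Rightarrow> nat \<Rightarrow> real"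
  assumes n: "2 \<le> n" and eps: "0 < eps" "eps \<le> \<Delta>" and \<Delta>: "\<Delta> \<le> 1"
    and p: "strat n p" and C: "\<And>i j. i < n \<Longrightarrow> j < n \<Longrightarrow> 0 \<le> C i j \<and> C i j \<le> 1"
    and N: "finite N" "real (card N) \<le> real n powr ((\<Delta> / eps)\<^sup>2)"
    and stable: "\<And>p'. strat n p' \<Longrightarrow> (\<And>i. 0 < p' i \<Longrightarrow> 0 < p i) \<Longrightarrow>
      (\<And>j. j < n \<Longrightarrow> \<bar>col_val n C p' j - col_val n C p j\<bar> \<le> eps / 2) \<Longrightarrow> \<exists>r\<in>N. sdist n p' r \<le> \<Delta>"
  shows "\<exists>p'. strat n p' \<and> (\<forall>i. 0 < p' i \<longrightarrow> 0 < p i) \<and>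
    (\<forall>j<n. \<bar>col_val n C p' j - col_val n C p j\<bar> \<le> eps / 2) \<and>
    real (card (supp n p')) \<le> 600000 * (\<Delta> / eps)\<^sup>2 * ln (1 + 1 / \<Delta>) * ln (real n)"
proof -
  define k where "k = \<Delta> / eps"
  define S where "S = nat \<lceil>1024 * k\<^sup>2 * ln (4 * real n)\<rceil>"
  define L where "L = nat \<lceil>log 2 (1 + 1 / \<Delta>)\<rceil>"
  \<comment> \<open>\<open>m / 8 = \<Delta>\<close> is the radius in
    \<open>resample_near_imp_hits\<close>, and \<open>m * \<tau> = eps / 2\<close> is the allowed
    payoff change.\<close>
  define m where "m = 8 * \<Delta>"
  define \<tau> where "\<tau> = 1 / (16 * k)"
  have \<Delta>0: "0 < \<Delta>" using eps by simp
  have k: "1 \<le> k" using eps by (simp add: k_def)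
  note S = sample_size_bounds[OF n k, folded S_def, folded \<tau>_def]
  note L = halving_rounds_bounds[OF \<Delta>0 \<Delta>, folded L_def]
  have m: "0 < m" using \<Delta>0 by (simp add: m_def)
  have \<tau>: "0 \<le> \<tau>" "\<tau> \<le> 2" using k by (auto simp: \<tau>_def field_simps)
  have m\<tau>: "m * \<tau> = eps / 2" using eps \<Delta>0 by (simp add: m_def \<tau>_def k_def field_simps)
  \<comment> \<open>At most \<open>40 * S\<close> atoms in each of \<open>L\<close> rounds, plus
    \<open>S\<close> draws; the constants multiply to 41 * 3074 * 4 = 504136.\<close>
  have size: "real (40 * S * L + S) \<le> 600000 * k\<^sup>2 * ln (1 + 1 / \<Delta>) * ln (real n)"
  proof -
    have "real (40 * S * L + S) \<le> real (41 * (S * L))"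
      using L(1) by (intro of_nat_mono) (simp add: Suc_le_eq)
    also have "\<dots> = 41 * (real S * real L)" by simp
    also have "\<dots> \<le> 41 * ((3074 * k\<^sup>2 * ln (real n)) * (4 * ln (1 + 1 / \<Delta>)))"
      using S(4) L(3) n by (intro mult_left_mono mult_mono) auto
    also have "\<dots> = 504136 * (k\<^sup>2 * ln (1 + 1 / \<Delta>) * ln (real n))" by simp
    also have "\<dots> \<le> 600000 * (k\<^sup>2 * ln (1 + 1 / \<Delta>) * ln (real n))"
      using n \<Delta>0 by (intro mult_right_mono mult_nonneg_nonneg) auto
    finally show ?thesis by (simp add: mult.assoc)
  qed
  have p0: "0 \<le> p i" if "i \<in> {..<n}" for i using p that by (auto simp: strat_def)
  obtain B where B: "B \<subseteq> {..<n}"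
    and alt: "(card B \<le> 40 * S * L \<and> sum p ({..<n} - B) \<le> max m ((1 / 2) ^ L)) \<or>
      (m \<le> sum p ({..<n} - B) \<and> (\<forall>i\<in>{..<n} - B. real (40 * S) * p i \<le> sum p ({..<n} - B)))"
    using concentrated_or_spread[of "{..<n}" p "40 * S" L m] p p0 by (auto simp: strat_def)
  have finB: "finite B" using B finite_subset by blast
  define t where "t = sum p ({..<n} - B)"
  have t0: "0 \<le> t" unfolding t_def by (intro sum_nonneg) (use p0 in auto)
  define P where "P i = (if i \<in> B then 0 else p i / t)" for i
  have P: "strat n P" if "0 < t"
    using strat_conditional[OF p B] that unfolding P_def[abs_def] t_def by simp
  from alt show ?thesis
  proof
    assume "card B \<le> 40 * S * L \<and> sum p ({..<n} - B) \<le> max m ((1 / 2) ^ L)"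
    then have cB: "card B \<le> 40 * S * L" and tm: "t \<le> m"
      using L(2) \<Delta>0 by (auto simp: t_def m_def)
    show ?thesis
    proof (cases "t = 0")
      case True
      \<comment> \<open>Nothing is left to normalise, and \<open>p\<close> itself already lives on
        \<open>B\<close>.\<close>
      have "p i = 0" if "i \<in> {..<n} - B" for i
        using sum_nonneg_0[of "{..<n} - B" p] that True p0 by (auto simp: t_def)
      then have "supp n p \<subseteq> B" by (force simp: supp_def)
      then have "card (supp n p) \<le> card B" by (rule card_mono[OF finB])
      then have "card (supp n p) \<le> 40 * S * L + S" using cB by linarith
      then have "real (card (supp n p)) \<le> real (40 * S * L + S)" by (rule of_nat_mono)
      then show ?thesis using p size eps by (intro exI[of _ p]) (auto simp: k_def)
    next
      case False
      then have t: "0 < t" using t0 by simp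
      have tP: "t * P i \<le> p i" if "i < n" for i using t p0 that by (auto simp: P_def)
      \<comment> \<open>No equilibrium has to be avoided here, so the family of forbidden sets is
        empty.\<close>
      have "2 * real n * exp (- (real S * \<tau>\<^sup>2 / 4)) + real (card ({}::nat set)) / 2 ^ S < 1"
        using S(2) by simp
      then have "\<exists>X. (\<forall>s<S. X s < n) \<and> strat n (resample p P t S X) \<and>
          (\<forall>i. 0 < resample p P t S X i \<longrightarrow> 0 < p i) \<and>
          (\<forall>j<n. \<bar>col_val n C (resample p P t S X) j - col_val n C p j\<bar> \<le> t * \<tau>) \<and>
          (\<forall>k\<in>{}::nat set. 2 * card {s. s < S \<and> X s \<in> {}} < S)"
        by (intro exists_resample) (use p P t tP C S(1) \<tau> in auto)
      then obtain X where X: "\<forall>s<S. X s < n" "strat n (resample p P t S X)"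
        "\<forall>i. 0 < resample p P t S X i \<longrightarrow> 0 < p i"
        "\<forall>j<n. \<bar>col_val n C (resample p P t S X) j - col_val n C p j\<bar> \<le> t * \<tau>"
        by blast
      have "t * \<tau> \<le> eps / 2" using mult_right_mono[OF tm \<tau>(1)] m\<tau> by simp
      then have err: "\<forall>j<n. \<bar>col_val n C (resample p P t S X) j - col_val n C p j\<bar> \<le> eps / 2"
        using X(4) by (meson order_trans)
      \<comment> \<open>All of \<open>p\<close> outside \<open>B\<close> is resampled, so only
        \<open>B\<close> and the drawn actions survive.\<close>
      have "supp n (resample p P t S X) \<subseteq> B \<union> X ` {..<S}"
      proof
        fix i assume "i \<in> supp n (resample p P t S X)"
        then have pos: "0 < resample p P t S X i" by (simp add: supp_def)
        show "i \<in> B \<union> X ` {..<S}"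
        proof (rule ccontr)
          assume i: "i \<notin> B \<union> X ` {..<S}"
          then have "{s. s < S \<and> X s = i} = {}" by auto
          moreover have "t * P i = p i" using i t by (simp add: P_def)
          ultimately show False using pos by (simp only: resample_def) simp
        qed
      qed
      then have "card (supp n (resample p P t S X)) \<le> card (B \<union> X ` {..<S})"
        using finB by (intro card_mono) auto
      also have "\<dots> \<le> card B + card (X ` {..<S})" by (rule card_Un_le)
      also have "\<dots> \<le> 40 * S * L + S" using cB card_image_le[of "{..<S}" X] by (simp add: add_mono)
      finally have "real (card (supp n (resample p P t S X))) \<le> real (40 * S * L + S)"
        by (rule of_nat_mono)
      then show ?thesis using X err size by (intro exI[of _ "resample p P t S X"]) (auto simp: k_def)
    qed
  next
    assume "m \<le> sum p ({..<n} - B) \<and> (\<forall>i\<in>{..<n} - B. real (40 * S) * p i \<le> sum p ({..<n} - B))"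
    then have mt: "m \<le> t" and sp: "\<And>i. i < n \<Longrightarrow> i \<notin> B \<Longrightarrow> 40 * real S * p i \<le> t"
      by (auto simp: t_def)
    have t: "0 < t" using m mt by simp
    have spread: "40 * real S * P i \<le> 1" if "i < n" for i
      using sp[OF that] t by (auto simp: P_def field_simps)
    \<comment> \<open>Only mass \<open>m\<close> is resampled even if \<open>t\<close> is larger, so
      that the payoff change stays within \<open>eps / 2\<close>.\<close>
    have mP: "m * P i \<le> p i" if "i < n" for i
    proof -
      have "m * P i \<le> t * P i" using mt t p0 that by (intro mult_right_mono) (auto simp: P_def)
      also have "\<dots> \<le> p i" using t p0 that by (auto simp: P_def)
      finally show ?thesis .
    qed
    define A where "A r = {i. m / (2 * real S) \<le> r i - p i + m * P i}" for r
    \<comment> \<open>Strategies \<open>r\<close> with a heavier \<open>A r\<close> can be left out: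
      by \<open>resample_near_imp_hits\<close> no resampled strategy comes within
      \<open>\<Delta>\<close> of them.\<close>
    define K where "K = {r \<in> N. sum P ({..<n} \<inter> A r) \<le> 1 / 16}"
    have K: "finite K" "real (card K) \<le> real (card N)"
      using N(1) by (auto simp: K_def intro: card_mono)
    have "2 * real (card K) < 2 ^ S" using K(2) N(2) S(3) by (simp add: k_def)
    then have "real (card K) / 2 ^ S < 1 / 2" by (simp add: field_simps)
    then have less: "2 * real n * exp (- (real S * \<tau>\<^sup>2 / 4)) + real (card K) / 2 ^ S < 1"
      using S(2) by linarith
    have "\<exists>X. (\<forall>s<S. X s < n) \<and> strat n (resample p P m S X) \<and>
        (\<forall>i. 0 < resample p P m S X i \<longrightarrow> 0 < p i) \<and>
        (\<forall>j<n. \<bar>col_val n C (resample p P m S X) j - col_val n C p j\<bar> \<le> m * \<tau>) \<and>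
        (\<forall>r\<in>K. 2 * card {s. s < S \<and> X s \<in> A r} < S)"
    proof (rule exists_resample[OF p P[OF t] m])
      show "sum P ({..<n} \<inter> A r) \<le> 1 / 16" if "r \<in> K" for r using that by (simp add: K_def)
    qed (use mP C S(1) K(1) \<tau> less in auto)
    then obtain X where X: "\<And>s. s < S \<Longrightarrow> X s < n" "strat n (resample p P m S X)"
      "\<And>i. 0 < resample p P m S X i \<Longrightarrow> 0 < p i"
      "\<And>j. j < n \<Longrightarrow> \<bar>col_val n C (resample p P m S X) j - col_val n C p j\<bar> \<le> m * \<tau>"
      "\<And>r. r \<in> K \<Longrightarrow> 2 * card {s. s < S \<and> X s \<in> A r} < S"
      by blast
    \<comment> \<open>Stability supplies an \<open>r\<close> near the resampled strategy; it lies in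
      \<open>K\<close> and its set receives half of the draws, contradicting the choice of
      \<open>X\<close>.\<close>
    obtain r where r: "r \<in> N" "sdist n (resample p P m S X) r \<le> m / 8"
      using stable[OF X(2,3) X(4)[unfolded m\<tau>]] by (auto simp: m_def)
    have "sum P ({..<n} \<inter> A r) \<le> 1 / 16 \<and> S \<le> 2 * card {s. s < S \<and> X s \<in> A r}"
      unfolding A_def by (rule resample_near_imp_hits[OF P[OF t] spread m S(1) X(1) r(2)])
    then show ?thesis using X(5)[of r] r(1) by (simp add: K_def)
  qed
qed

section \<open>Combining the two players\<close>

text \<open>Comparing two actions doubles the error \<open>eps / 2\<close>, and all actions still
  played were exact best responses before.\<close>

lemma ws_eq_of_approximation:
  assumes nash: "nash n R C p q" and strat: "strat n p'" "strat n q'"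
    and supp: "\<And>i. 0 < p' i \<Longrightarrow> 0 < p i" "\<And>i. 0 < q' i \<Longrightarrow> 0 < q i"
    and row: "\<And>i. i < n \<Longrightarrow> \<bar>row_val n R q' i - row_val n R q i\<bar> \<le> eps / 2"
    and col: "\<And>j. j < n \<Longrightarrow> \<bar>col_val n C p' j - col_val n C p j\<bar> \<le> eps / 2"
  shows "ws_eq n R C eps p' q'"
proof -
  have ws: "ws_eq n R C 0 p q" using nash by (rule nash_imp_ws_eq_zero)
  show ?thesis unfolding ws_eq_def
  proof (intro conjI allI impI strat)
    fix i j assume "i < n" "0 < p' i" "j < n"
    then have "row_val n R q j \<le> row_val n R q i" using ws supp by (auto simp: ws_eq_def)
    then show "row_val n R q' j - eps \<le> row_val n R q' i"
      using row[OF \<open>i < n\<close>] row[OF \<open>j < n\<close>] unfolding abs_le_iff by argo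
  next
    fix i j assume "i < n" "0 < q' i" "j < n"
    then have "col_val n C p j \<le> col_val n C p i" using ws supp by (auto simp: ws_eq_def)
    then show "col_val n C p' j - eps \<le> col_val n C p' i"
      using col[OF \<open>i < n\<close>] col[OF \<open>j < n\<close>] unfolding abs_le_iff by argo
  qed
qed

text \<open>Each player is made sparse while the other stays at the fixed equilibrium. The results
  combine because row values depend only on the column player's strategy, and vice versa.\<close>

lemma sparse_ws_eq:
  assumes n: "2 \<le> n" and eps: "0 < eps" "eps \<le> \<Delta>" and \<Delta>: "\<Delta> \<le> 1"
    and game: "\<forall>i<n. \<forall>j<n. 0 \<le> R i j \<and> R i j \<le> 1 \<and> 0 \<le> C i j \<and> C i j \<le> 1"
    and fin: "finite (nash_set n R C)"
    and few: "real (card (nash_set n R C)) \<le> real n powr ((\<Delta> / eps)\<^sup>2)"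
    and stable: "ws_approx_stable n R C eps \<Delta>"
  shows "\<exists>p q. ws_eq n R C eps p q \<and>
    real (card (supp n p)) \<le> 600000 * (\<Delta> / eps)\<^sup>2 * ln (1 + 1 / \<Delta>) * ln (real n) \<and>
    real (card (supp n q)) \<le> 600000 * (\<Delta> / eps)\<^sup>2 * ln (1 + 1 / \<Delta>) * ln (real n)"
proof -
  obtain p q where pq: "nash n R C p q" using nash_exists[of n R C] n by auto
  then have p: "strat n p" and q: "strat n q" by (auto simp: nash_def)
  have few': "real (card (f ` nash_set n R C)) \<le> real n powr ((\<Delta> / eps)\<^sup>2)" for f :: "_ \<Rightarrow> nat \<Rightarrow> real"
    using card_image_le[OF fin, of f] few by linarith
  have row: "row_val n R x i = col_val n (\<lambda>j i. R i j) x i" for x i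
    by (simp add: col_val_eq_row_val)
  obtain p' where p': "strat n p'" "\<And>i. 0 < p' i \<Longrightarrow> 0 < p i"
    "\<And>j. j < n \<Longrightarrow> \<bar>col_val n C p' j - col_val n C p j\<bar> \<le> eps / 2"
    "real (card (supp n p')) \<le> 600000 * (\<Delta> / eps)\<^sup>2 * ln (1 + 1 / \<Delta>) * ln (real n)"
  proof -
    \<comment> \<open>Together with the unchanged \<open>q\<close>, \<open>x\<close> forms a
      well-supported \<open>eps\<close>-equilibrium, so stability places it near the first component
      of an equilibrium.\<close>
    have "\<exists>r\<in>fst ` nash_set n R C. sdist n x r \<le> \<Delta>"
      if "strat n x" "\<And>i. 0 < x i \<Longrightarrow> 0 < p i"
        "\<And>j. j < n \<Longrightarrow> \<bar>col_val n C x j - col_val n C p j\<bar> \<le> eps / 2" for x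
    proof -
      have "ws_eq n R C eps x q"
        by (rule ws_eq_of_approximation[OF pq that(1) q that(2) _ _ that(3)]) (use eps in auto)
      then show ?thesis using stable by (force simp: ws_approx_stable_def pdist_def)
    qed
    from sparse_approximation[OF n eps \<Delta> p _ finite_imageI[OF fin] few' this, of C]
    show ?thesis using game that by blast
  qed
  obtain q' where q': "strat n q'" "\<And>i. 0 < q' i \<Longrightarrow> 0 < q i"
    "\<And>i. i < n \<Longrightarrow> \<bar>row_val n R q' i - row_val n R q i\<bar> \<le> eps / 2"
    "real (card (supp n q')) \<le> 600000 * (\<Delta> / eps)\<^sup>2 * ln (1 + 1 / \<Delta>) * ln (real n)"
  proof -
    have "\<exists>r\<in>snd ` nash_set n R C. sdist n x r \<le> \<Delta>"
      if "strat n x" "\<And>i. 0 < x i \<Longrightarrow> 0 < q i"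
        "\<And>j. j < n \<Longrightarrow> \<bar>col_val n (\<lambda>j i. R i j) x j - col_val n (\<lambda>j i. R i j) q j\<bar> \<le> eps / 2" for x
    proof -
      have "ws_eq n R C eps p x"
        by (rule ws_eq_of_approximation[OF pq p that(1) _ that(2)]) (use eps that(3) row in auto)
      then show ?thesis using stable by (force simp: ws_approx_stable_def pdist_def)
    qed
    from sparse_approximation[OF n eps \<Delta> q _ finite_imageI[OF fin] few' this, of "\<lambda>j i. R i j"]
    show ?thesis using game that unfolding row by blast
  qed
  have "ws_eq n R C eps p' q'"
    by (rule ws_eq_of_approximation[OF pq p'(1) q'(1) p'(2) q'(2) q'(3) p'(3)])
  then show ?thesis using p' q' by blast
qed

theorem theorem2:
  shows "\<exists>a b :: real. 0 < a \<and> 0 < b \<and>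
    (\<forall>(n::nat) (eps::real) (Delta::real) R C.
       2 \<le> n \<longrightarrow> 0 < eps \<longrightarrow> eps \<le> Delta \<longrightarrow> Delta \<le> 1 \<longrightarrow>
       (\<forall>i<n. \<forall>j<n. 0 \<le> R i j \<and> R i j \<le> 1 \<and> 0 \<le> C i j \<and> C i j \<le> 1) \<longrightarrow>
       finite (nash_set n R C) \<longrightarrow>
       real (card (nash_set n R C)) \<le> real n powr (a * (Delta / eps)^2) \<longrightarrow>
       (ws_approx_stable n R C eps Delta \<or> perturb_stable n R C (eps / 2) Delta) \<longrightarrow>
       (\<exists>p q. ws_eq n R C eps p q \<and>
          real (card (supp n p)) \<le> b * (Delta / eps)^2 * ln (1 + 1 / Delta) * ln (real n) \<and>
          real (card (supp n q)) \<le> b * (Delta / eps)^2 * ln (1 + 1 / Delta) * ln (real n)))"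
proof (rule exI[of _ 1], rule exI[of _ 600000], intro conjI allI impI)
  fix n :: nat and eps Delta :: real and R C :: "nat \<Rightarrow> nat \<Rightarrow> real"
  assume eps: "0 < eps" and "ws_approx_stable n R C eps Delta \<or> perturb_stable n R C (eps / 2) Delta"
  then have "ws_approx_stable n R C eps Delta"
    using perturb_stable_imp_ws_approx_stable[of n R C eps Delta] by auto
  moreover assume "2 \<le> n" "eps \<le> Delta" "Delta \<le> 1"
    "\<forall>i<n. \<forall>j<n. 0 \<le> R i j \<and> R i j \<le> 1 \<and> 0 \<le> C i j \<and> C i j \<le> 1"
    "finite (nash_set n R C)" "real (card (nash_set n R C)) \<le> real n powr (1 * (Delta / eps)^2)"
  ultimately show "\<exists>p q. ws_eq n R C eps p q \<and>
    real (card (supp n p)) \<le> 600000 * (Delta / eps)^2 * ln (1 + 1 / Delta) * ln (real n) \<and>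
    real (card (supp n q)) \<le> 600000 * (Delta / eps)^2 * ln (1 + 1 / Delta) * ln (real n)"
    using sparse_ws_eq[of n eps Delta R C] eps by simp
qed simp_all

end
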